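(* Let $K$ be a compact subset of $E_1$. Then there exist $C=C(K)$ and $\varepsilon=\varepsilon(K)>0$ such that for all $n\in\mathbb{N}$, $$\mathbb{P}\left[\exists\,\beta\in K:\mathcal{Z}_n(\beta)=0\right]<C\,e^{-\varepsilon n}.$$
   Context: GREM. Fix $d\in\mathbb{N}$, variances $a_1,\dots,a_d>0$, branching exponents $\alpha_1,\dots,\alpha_d>1$, and sequences of natural numbers $N_{n,1},\dots,N_{n,d}$ with $\lim_{n\to\infty}N_{n,j}/\alpha_j^n=1$ for each $j$. Let $\mathbb{S}_n=\{\varepsilon=(\varepsilon_1,\dots,\varepsilon_d)\in\mathbb{N}^d:1\le\varepsilon_j\le N_{n,j},\ 1\le j\le d\}$. Let $\{\xi_{\varepsilon_1\dots\varepsilon_j}:1\le j\le d,\ 1\le\varepsilon_i\le N_{n,i}\}$ be independent real standard normal random variables, $X_\varepsilon=\sum_{j=1}^d\sqrt{a_j}\,\xi_{\varepsilon_1\dots\varepsilon_j}$, and $\mathcal{Z}_n(\beta)=\sum_{\varepsilon\in\mathbb{S}_n}e^{\beta\sqrt n X_\varepsilon}$, $\beta=\sigma+i\tau\in\mathbb{C}$. Put $\sigma_j=\sqrt{2\log\alpha_j/a_j}$; it is assumed throughout that $\sigma_1<\dots<\sigma_d$. $E_1=\mathbb{C}\setminus\overline{G_1\cup F_1}$, where $G_1=\{\beta:2|\sigma|>\sigma_1,\ |\sigma|+|\tau|>\sigma_1\}$ and $F_1=\{\beta:2|\sigma|<\sigma_1,\ 2(\sigma^2+\tau^2)>\sigma_1^2\}$.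 *)

theory Defs
  imports "HOL-Probability.Probability"
begin

text \<open>
  Levels are numbered \<open>1, \<dots>, d\<close>, and the sequences \<open>a\<close>, \<open>\<alpha>\<close>, \<open>N n\<close> are read at these arguments only.
  A multi-index \<open>\<epsilon>\<^sub>1\<dots>\<epsilon>\<^sub>j\<close> is a list of length \<open>j\<close>; list positions start at \<open>0\<close>, so \<open>\<epsilon>\<^sub>i\<close> is
  \<open>\<epsilon> ! (i - 1)\<close>. The prefix \<open>\<epsilon>\<^sub>1\<dots>\<epsilon>\<^sub>j\<close> of \<open>\<epsilon>\<close> is \<open>take j \<epsilon>\<close>.
\<close>

definition grem_words :: "(nat \<Rightarrow> nat \<Rightarrow> nat) \<Rightarrow> nat \<Rightarrow> nat \<Rightarrow> nat list set" where
  "grem_words N n j = {w. length w = j \<and> (\<forall>i\<in>{1..j}. 1 \<le> w ! (i - 1) \<and> w ! (i - 1) \<le> N n i)}"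

definition grem_states :: "nat \<Rightarrow> (nat \<Rightarrow> nat \<Rightarrow> nat) \<Rightarrow> nat \<Rightarrow> nat list set" where
  "grem_states d N n = grem_words N n d"

definition grem_index :: "nat \<Rightarrow> (nat \<Rightarrow> nat \<Rightarrow> nat) \<Rightarrow> nat \<Rightarrow> nat list set" where
  "grem_index d N n = (\<Union>j\<in>{1..d}. grem_words N n j)"

definition grem_X :: "nat \<Rightarrow> (nat \<Rightarrow> real) \<Rightarrow> (nat list \<Rightarrow> 'w \<Rightarrow> real) \<Rightarrow> nat list \<Rightarrow> 'w \<Rightarrow> real" where
  "grem_X d a \<xi> \<epsilon> \<omega> = (\<Sum>j=1..d. sqrt (a j) * \<xi> (take j \<epsilon>) \<omega>)"

definition grem_Z ::
  "nat \<Rightarrow> (nat \<Rightarrow> real) \<Rightarrow> (nat \<Rightarrow> nat \<Rightarrow> nat) \<Rightarrow> (nat \<Rightarrow> nat list \<Rightarrow> 'w \<Rightarrow> real)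
     \<Rightarrow> nat \<Rightarrow> complex \<Rightarrow> 'w \<Rightarrow> complex" where
  "grem_Z d a N \<xi> n \<beta> \<omega> =
     (\<Sum>\<epsilon>\<in>grem_states d N n. exp (\<beta> * of_real (sqrt (real n)) * of_real (grem_X d a (\<xi> n) \<epsilon> \<omega>)))"

definition grem_sigma :: "(nat \<Rightarrow> real) \<Rightarrow> (nat \<Rightarrow> real) \<Rightarrow> nat \<Rightarrow> real" where
  "grem_sigma a \<alpha> j = sqrt (2 * ln (\<alpha> j) / a j)"

definition G1 :: "(nat \<Rightarrow> real) \<Rightarrow> (nat \<Rightarrow> real) \<Rightarrow> complex set" where
  "G1 a \<alpha> = {\<beta>. 2 * \<bar>Re \<beta>\<bar> > grem_sigma a \<alpha> 1 \<and> \<bar>Re \<beta>\<bar> + \<bar>Im \<beta>\<bar> > grem_sigma a \<alpha> 1}"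

definition F1 :: "(nat \<Rightarrow> real) \<Rightarrow> (nat \<Rightarrow> real) \<Rightarrow> complex set" where
  "F1 a \<alpha> = {\<beta>. 2 * \<bar>Re \<beta>\<bar> < grem_sigma a \<alpha> 1 \<and>
                 2 * ((Re \<beta>)\<^sup>2 + (Im \<beta>)\<^sup>2) > (grem_sigma a \<alpha> 1)\<^sup>2}"

definition E1 :: "(nat \<Rightarrow> real) \<Rightarrow> (nat \<Rightarrow> real) \<Rightarrow> complex set" where
  "E1 a \<alpha> = - closure (G1 a \<alpha> \<union> F1 a \<alpha>)"

end

theory Submission
  imports Defs "HOL-Complex_Analysis.Complex_Analysis"
begin

text \<open>
  Dividing \<open>Z\<^sub>n(\<beta>)\<close> by its expectation gives the average over the leaves of a product of independent
  mean-one factors along the path to the leaf, and subtracting \<open>1\<close> turns it into a sum of martingale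
  differences indexed by all nodes of the tree. A von Bahr--Esseen inequality bounds its \<open>p\<close>-th moment,
  \<open>1 < p \<le> 2\<close>, by a sum over the levels \<open>k\<close> of products over \<open>j \<le> k\<close> of factors that are, up to constants,
  \<open>exp (n a\<^sub>j / 2 * (p (p - 1) \<sigma>\<^sup>2 + p \<tau>\<^sup>2 - (p - 1) \<sigma>\<^sub>j\<^sup>2))\<close>. As \<open>\<sigma>\<^sub>1\<close> is the smallest of the \<open>\<sigma>\<^sub>j\<close>, everything decays
  exponentially once the first level does, and \<open>\<beta>\<close> lies in \<open>E\<^sub>1\<close> only if some \<open>p\<close> achieves this near \<open>\<beta>\<close>.
  Cauchy's formula passes from moments at fixed \<open>\<beta>\<close> to the supremum over a small disc, a zero forces this
  supremum to be at least \<open>1\<close>, and finitely many discs cover \<open>K\<close>.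
\<close>

section \<open>Moment inequalities\<close>

text \<open>The middle term is linear in \<open>y\<close>, so it vanishes in mean for centred \<open>y\<close> independent of \<open>x\<close>:
  this yields a von Bahr--Esseen inequality.\<close>

lemma norm_add_powr_le:
  fixes x y :: complex
  assumes p: "1 \<le> p" "p \<le> 2"
  shows "norm (x + y) powr p
    \<le> norm x powr p + p * norm x powr (p - 2) * Re (cnj x * y) + 6 * norm y powr p"
proof (cases "norm y \<le> norm x \<and> x \<noteq> 0")
  case True
  define q where "q = (norm (x + y))\<^sup>2 / (norm x)\<^sup>2"
  have nx: "norm x > 0" using True by simp
  have q0: "q \<ge> 0" by (simp add: q_def)
  \<comment> \<open>Young's inequality with weights \<open>p/2\<close> and \<open>1 - p/2\<close> is
    the tangent bound at \<open>1\<close> for the concave function \<open>q powr (p/2)\<close>.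
    Being linear in \<open>q\<close>, it lets the squared norm of the sum be expanded.\<close>
  have "q powr (p/2) \<le> (p/2) * q + (1 - p/2)"
    using Youngs_inequality_0[of "p/2" "1 - p/2" q 1] p q0 by (cases "q = 0") auto
  moreover have "norm x powr p * q powr (p/2) = norm (x + y) powr p"
  proof -
    have "q powr (p/2) = norm (x + y) powr p / norm x powr p"
      unfolding q_def using nx
      by (simp add: powr_divide powr_powr flip: powr_numeral)
    then show ?thesis using nx by simp
  qed
  ultimately have 1: "norm (x + y) powr p \<le> norm x powr p * ((p/2) * q + (1 - p/2))"
    by (metis mult_left_mono powr_ge_zero)
  have px: "norm x powr p = norm x powr (p - 2) * (norm x)\<^sup>2"
    using nx by (simp add: powr_diff)
  have nq: "(norm x)\<^sup>2 * q = (norm x)\<^sup>2 + 2 * Re (cnj x * y) + (norm y)\<^sup>2"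
  proof -
    have "(norm x)\<^sup>2 * q = (norm (x + y))\<^sup>2"
      using nx by (simp add: q_def)
    then show ?thesis
      unfolding cmod_power2 by (simp add: power2_eq_square algebra_simps)
  qed
  have "norm x powr p * ((p/2) * q + (1 - p/2))
      = norm x powr (p - 2) * ((p/2) * ((norm x)\<^sup>2 * q) + (1 - p/2) * (norm x)\<^sup>2)"
    unfolding px by (simp add: algebra_simps)
  also have "\<dots> = norm x powr (p - 2) * (norm x)\<^sup>2 + p * norm x powr (p - 2) * Re (cnj x * y)
      + p / 2 * (norm x powr (p - 2) * (norm y)\<^sup>2)"
    unfolding nq by (simp add: algebra_simps)
  finally have 2: "norm x powr p * ((p/2) * q + (1 - p/2)) = norm x powr p
      + p * norm x powr (p - 2) * Re (cnj x * y) + p / 2 * (norm x powr (p - 2) * (norm y)\<^sup>2)"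
    unfolding px .
  \<comment> \<open>The exponent \<open>p - 2\<close> is nonpositive, so passing from
    \<open>norm x\<close> to the smaller \<open>norm y\<close> increases the power.\<close>
  have 3: "norm x powr (p - 2) * (norm y)\<^sup>2 \<le> norm y powr p"
  proof (cases "y = 0")
    case False
    then have "norm x powr (p - 2) * (norm y)\<^sup>2 \<le> norm y powr (p - 2) * (norm y)\<^sup>2"
      using True p by (intro mult_right_mono powr_mono2') auto
    also have "\<dots> = norm y powr p"
      using False by (simp add: powr_diff)
    finally show ?thesis .
  qed simp
  have "p / 2 * (norm x powr (p - 2) * (norm y)\<^sup>2) \<le> 6 * norm y powr p"
    using 3 p by (intro mult_mono) auto
  then show ?thesis using 1 2 by linarith
next
  case False
  show ?thesis
  proof (cases "x = 0")
    case True then show ?thesis by simp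
  next
    case x0: False
    then have xy: "norm x < norm y" using False by simp
    have nx: "norm x > 0" using x0 by simp
    \<comment> \<open>Here \<open>y\<close> dominates: the left-hand side costs at most
      \<open>4 * norm y powr p\<close> and the possibly negative linear term at most
      \<open>2 * norm y powr p\<close>, whence the constant \<open>6\<close>.\<close>
    have "norm (x + y) powr p \<le> (2 * norm y) powr p"
      using p xy norm_triangle_ineq[of x y] by (intro powr_mono2) auto
    also have "\<dots> \<le> 4 * norm y powr p"
      using p powr_mono[of p 2 2] by (simp add: powr_mult mult_right_mono)
    finally have 1: "norm (x + y) powr p \<le> 4 * norm y powr p" .
    have "- (p * norm x powr (p - 2) * Re (cnj x * y)) \<le> p * norm x powr (p - 2) * norm (cnj x * y)"
      using p abs_Re_le_cmod[of "cnj x * y"]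
      by (subst minus_mult_right) (intro mult_left_mono, auto)
    also have "\<dots> = p * norm x powr (p - 1) * norm y"
      using nx by (simp add: norm_mult powr_diff power2_eq_square)
    also have "\<dots> \<le> p * norm y powr (p - 1) * norm y"
      using p xy by (intro mult_right_mono mult_left_mono powr_mono2) auto
    also have "\<dots> = p * norm y powr p"
      using nx xy by (simp add: powr_diff)
    also have "\<dots> \<le> 2 * norm y powr p" using p by (intro mult_right_mono) auto
    finally show ?thesis using 1 powr_ge_zero[of "norm x" p] by linarith
  qed
qed

lemma powr_add_le:
  fixes x y p :: real
  assumes "0 \<le> x" "0 \<le> y" "0 \<le> p" "p \<le> 2"
  shows "(x + y) powr p \<le> 4 * (x powr p + y powr p)"
proof -
  have "(x + y) powr p \<le> (2 * max x y) powr p"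
    using assms by (intro powr_mono2) auto
  also have "\<dots> \<le> 4 * max x y powr p"
    using assms powr_mono[of p 2 2] by (simp add: powr_mult mult_right_mono)
  also have "\<dots> \<le> 4 * (x powr p + y powr p)"
    by (auto simp: max_def)
  finally show ?thesis .
qed

section \<open>Exponential moments of a standard normal variable\<close>

text \<open>Completing the square: shifting the integration variable by \<open>Re z\<close> turns
  the real part of the exponent into a constant factor, and what remains is the characteristic
  function at \<open>Im z\<close>.\<close>

lemma has_integral_std_normal_exp:
  fixes z :: complex
  shows "has_bochner_integral std_normal_distribution (\<lambda>x. exp (z * of_real x)) (exp (z\<^sup>2 / 2))"
proof -
  interpret real_distribution std_normal_distribution by (rule real_dist_normal_dist)
  define s t where "s = Re z" and "t = Im z"
  have z: "z = of_real s + \<i> * of_real t" by (simp add: s_def t_def complex_eq_iff)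
  have "has_bochner_integral std_normal_distribution (\<lambda>x. iexp (t * x)) (exp (- (of_real t^2) / 2))"
    unfolding has_bochner_integral_iff
    using fun_cong[OF char_std_normal_distribution, of t]
    by (auto simp: char_def exp_of_real[symmetric] intro!: integrable_iexp)
  then have 1: "has_bochner_integral lborel (\<lambda>x. std_normal_density x *\<^sub>R iexp (t * x))
      (exp (- (of_real t^2) / 2))"
    by (simp add: has_bochner_integral_iff integrable_density integral_density)
  \<comment> \<open>The shape \<open>s + 1 * x\<close> is that of the affine change of variables
    used below.\<close>
  have 2: "std_normal_density (s + 1 * x) *\<^sub>R exp (z * of_real (s + 1 * x)) =
      exp (z * s - s^2/2) * (std_normal_density x *\<^sub>R iexp (t * x))" for x
  proof -
    have "std_normal_density (s + x) = std_normal_density x * exp (- s * x - s^2/2)"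
      unfolding std_normal_density_def
      by (simp add: mult_exp_exp power2_eq_square field_simps)
    then have "std_normal_density (s + 1 * x) *\<^sub>R exp (z * of_real (s + 1 * x))
      = of_real (std_normal_density x) * (exp (of_real (- s * x - s^2/2)) * exp (z * of_real (s + x)))"
      unfolding scaleR_conv_of_real by (simp only: mult_1 exp_of_real of_real_mult mult.assoc)
    also have "exp (of_real (- s * x - s^2/2)) * exp (z * of_real (s + x))
       = exp (z * s - s^2/2) * iexp (t * x)"
      unfolding mult_exp_exp by (rule arg_cong[where f=exp]) (simp add: z algebra_simps)
    finally show ?thesis unfolding scaleR_conv_of_real by (simp add: ac_simps)
  qed
  have 3: "has_bochner_integral lborel (\<lambda>x. std_normal_density (s + 1 * x) *\<^sub>R exp (z * of_real (s + 1 * x)))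
      (exp (z * s - s^2/2) * exp (- (of_real t^2) / 2))"
    unfolding 2 by (intro has_bochner_integral_mult_right 1)
  have "exp (z * s - s^2/2) * exp (- (of_real t^2) / 2) = exp (z\<^sup>2 / 2)"
    unfolding mult_exp_exp
    by (rule arg_cong[where f=exp]) (simp add: z power2_eq_square algebra_simps)
  then have "has_bochner_integral lborel (\<lambda>x. std_normal_density x *\<^sub>R exp (z * of_real x)) (exp (z\<^sup>2 / 2))"
    using 3 lborel_has_bochner_integral_real_affine_iff[of 1 "\<lambda>x. std_normal_density x *\<^sub>R exp (z * of_real x)" _ s]
    by simp
  then show ?thesis
    by (simp add: has_bochner_integral_iff integrable_density integral_density)
qed

lemma (in prob_space) has_integral_exp_std_normal:
  fixes z :: complex
  assumes "distributed M lborel X std_normal_density"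
  shows "has_bochner_integral M (\<lambda>\<omega>. exp (z * of_real (X \<omega>))) (exp (z\<^sup>2 / 2))"
proof -
  have [measurable]: "X \<in> borel_measurable M" using distributed_measurable[OF assms] by simp
  have "distr M borel X = distr M lborel X" by (rule distr_cong) auto
  also have "\<dots> = std_normal_distribution"
    using distributed_distr_eq_density[OF assms] by simp
  finally have "distr M borel X = std_normal_distribution" .
  then have "has_bochner_integral (distr M borel X) (\<lambda>x. exp (z * of_real x)) (exp (z\<^sup>2 / 2))"
    using has_integral_std_normal_exp by simp
  then show ?thesis
    by (simp add: has_bochner_integral_iff integrable_distr_eq integral_distr)
qed

text \<open>The norm depends on \<open>Re z\<close> only, so its power is again an exponential of
  the variable and the complex formula applies at the real argument \<open>p * Re z\<close>.\<close>

lemma (in prob_space) has_integral_norm_exp_std_normal: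
  fixes z :: complex
  assumes "distributed M lborel X std_normal_density"
  shows "has_bochner_integral M (\<lambda>\<omega>. norm (exp (z * of_real (X \<omega>))) powr p) (exp ((p * Re z)\<^sup>2 / 2))"
proof -
  have "has_bochner_integral M (\<lambda>\<omega>. Re (exp (of_real (p * Re z) * of_real (X \<omega>)))) (Re (exp ((of_real (p * Re z))\<^sup>2 / 2)))"
    by (intro has_bochner_integral_Re has_integral_exp_std_normal assms)
  also have "(\<lambda>\<omega>. Re (exp (of_real (p * Re z) * of_real (X \<omega>)))) = (\<lambda>\<omega>. norm (exp (z * of_real (X \<omega>))) powr p)"
    by (auto simp: fun_eq_iff powr_def exp_of_real simp flip: of_real_mult)
  also have "Re (exp ((of_real (p * Re z))\<^sup>2 / 2)) = exp ((p * Re z)\<^sup>2 / 2)"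
    by (metis Re_complex_of_real exp_of_real of_real_divide of_real_numeral of_real_power)
  finally show ?thesis .
qed

text \<open>The pointwise inequality is integrated with \<open>x = X\<close> and
  \<open>y = B * Z\<close>. Since \<open>X\<close> and \<open>B\<close> are functions of
  \<open>U\<close> and \<open>Z\<close> is one of \<open>V\<close>, the coefficient of
  \<open>Z\<close> in the linear term is independent of the centred \<open>Z\<close>, so that term
  has mean zero, and the moment of \<open>B * Z\<close> factors.\<close>

lemma (in prob_space) norm_add_moment_le:
  fixes U V :: "'a \<Rightarrow> 'b" and F G H :: "'b \<Rightarrow> complex"
  defines "X \<equiv> \<lambda>\<omega>. F (U \<omega>)" and "B \<equiv> \<lambda>\<omega>. G (U \<omega>)" and "Z \<equiv> \<lambda>\<omega>. H (V \<omega>)"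
  assumes p: "1 \<le> p" "p \<le> 2"
    and ind: "indep_var S U T V"
    and [measurable]: "F \<in> borel_measurable S" "G \<in> borel_measurable S" "H \<in> borel_measurable T"
    and iX: "integrable M (\<lambda>\<omega>. norm (X \<omega>) powr p)"
    and iB: "integrable M (\<lambda>\<omega>. norm (B \<omega>) powr p)"
    and iZ: "integrable M (\<lambda>\<omega>. norm (Z \<omega>) powr p)"
    and Z0: "has_bochner_integral M Z 0"
  shows "integrable M (\<lambda>\<omega>. norm (X \<omega> + B \<omega> * Z \<omega>) powr p)"
    and "expectation (\<lambda>\<omega>. norm (X \<omega> + B \<omega> * Z \<omega>) powr p)
      \<le> expectation (\<lambda>\<omega>. norm (X \<omega>) powr p)
        + 6 * (expectation (\<lambda>\<omega>. norm (B \<omega>) powr p) * expectation (\<lambda>\<omega>. norm (Z \<omega>) powr p))"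
proof -
  have [measurable]: "U \<in> measurable M S" "V \<in> measurable M T"
    using indep_var_rv1[OF ind] indep_var_rv2[OF ind] .
  have [measurable]: "X \<in> borel_measurable M" "B \<in> borel_measurable M" "Z \<in> borel_measurable M"
    unfolding X_def B_def Z_def by measurable
  define g where "g \<omega> = of_real (p * norm (X \<omega>) powr (p - 2)) * cnj (X \<omega>) * B \<omega>" for \<omega>
  have [measurable]: "cnj \<in> borel_measurable borel"
    by (intro borel_measurable_continuous_onI continuous_intros)
  have "indep_var borel ((\<lambda>u. of_real (p * norm (F u) powr (p - 2)) * cnj (F u) * G u) \<circ> U) borel (H \<circ> V)"
    by (rule indep_var_compose[OF ind]) measurable
  then have ind_g: "indep_var borel g borel Z"
    by (simp add: g_def[abs_def] X_def B_def Z_def comp_def)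
  have "indep_var borel ((\<lambda>u. norm (G u) powr p) \<circ> U) borel ((\<lambda>v. norm (H v) powr p) \<circ> V)"
    by (rule indep_var_compose[OF ind]) measurable
  then have ind_p: "indep_var borel (\<lambda>\<omega>. norm (B \<omega>) powr p) borel (\<lambda>\<omega>. norm (Z \<omega>) powr p)"
    by (simp add: B_def Z_def comp_def)
  have BZ: "norm (B \<omega> * Z \<omega>) powr p = norm (B \<omega>) powr p * norm (Z \<omega>) powr p" for \<omega>
    by (simp add: norm_mult powr_mult)
  have iBZ: "integrable M (\<lambda>\<omega>. norm (B \<omega> * Z \<omega>) powr p)"
    unfolding BZ by (rule indep_var_integrable[OF ind_p iB iZ])
  show int: "integrable M (\<lambda>\<omega>. norm (X \<omega> + B \<omega> * Z \<omega>) powr p)"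
  proof (rule Bochner_Integration.integrable_bound)
    show "integrable M (\<lambda>\<omega>. 4 * (norm (X \<omega>) powr p + norm (B \<omega> * Z \<omega>) powr p))"
      using iX iBZ by simp
    have "norm (X \<omega> + B \<omega> * Z \<omega>) powr p \<le> 4 * (norm (X \<omega>) powr p + norm (B \<omega> * Z \<omega>) powr p)" for \<omega>
      using powr_add_le[of "norm (X \<omega>)" "norm (B \<omega> * Z \<omega>)" p] p
        powr_mono2[of p "norm (X \<omega> + B \<omega> * Z \<omega>)" "norm (X \<omega>) + norm (B \<omega> * Z \<omega>)"]
        norm_triangle_ineq[of "X \<omega>" "B \<omega> * Z \<omega>"]
      by simp
    then show "AE \<omega> in M. norm (norm (X \<omega> + B \<omega> * Z \<omega>) powr p)
        \<le> norm (4 * (norm (X \<omega>) powr p + norm (B \<omega> * Z \<omega>) powr p))"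
      by simp
  qed measurable
  have ig: "integrable M g"
  proof (rule Bochner_Integration.integrable_bound)
    show "integrable M (\<lambda>\<omega>. 2 * (norm (X \<omega>) powr p + norm (B \<omega>) powr p))"
      using iX iB by simp
    have "norm (g \<omega>) \<le> 2 * (norm (X \<omega>) powr p + norm (B \<omega>) powr p)" for \<omega>
    proof (cases "X \<omega> = 0")
      case False
      \<comment> \<open>Replacing both norms by the larger one merges the mixed product into a
        single \<open>m powr p\<close>, which is one of the two integrable powers.\<close>
      define m where "m = max (norm (X \<omega>)) (norm (B \<omega>))"
      have "m > 0" using False by (simp add: m_def less_max_iff_disj)
      have "norm (g \<omega>) = p * (norm (X \<omega>) powr (p - 1) * norm (B \<omega>))"
        using False p by (simp add: g_def norm_mult norm_divide powr_diff power2_eq_square)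
      also have "\<dots> \<le> 2 * (m powr (p - 1) * m)"
        using p by (intro mult_mono powr_mono2) (auto simp: m_def)
      also have "m powr (p - 1) * m = m powr p"
        using \<open>m > 0\<close> by (simp add: powr_diff)
      also have "\<dots> \<le> norm (X \<omega>) powr p + norm (B \<omega>) powr p"
        by (simp add: m_def max_def)
      finally show ?thesis by simp
    qed (simp add: g_def)
    then show "AE \<omega> in M. norm (g \<omega>) \<le> norm (2 * (norm (X \<omega>) powr p + norm (B \<omega>) powr p))"
      by simp
  qed (rule indep_var_rv1[OF ind_g])
  have iZ1: "integrable M Z" and EZ: "expectation Z = 0"
    using Z0 by (auto simp: has_bochner_integral_iff)
  have igZ: "integrable M (\<lambda>\<omega>. g \<omega> * Z \<omega>)"
    by (rule indep_var_integrable[OF ind_g ig iZ1])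
  have EgZ: "expectation (\<lambda>\<omega>. g \<omega> * Z \<omega>) = 0"
    using indep_var_lebesgue_integral[OF ind_g ig iZ1] EZ by simp
  have EBZ: "expectation (\<lambda>\<omega>. norm (B \<omega> * Z \<omega>) powr p)
      = expectation (\<lambda>\<omega>. norm (B \<omega>) powr p) * expectation (\<lambda>\<omega>. norm (Z \<omega>) powr p)"
    unfolding BZ by (rule indep_var_lebesgue_integral[OF ind_p iB iZ])
  have "expectation (\<lambda>\<omega>. norm (X \<omega> + B \<omega> * Z \<omega>) powr p) \<le>
      expectation (\<lambda>\<omega>. norm (X \<omega>) powr p + Re (g \<omega> * Z \<omega>) + 6 * norm (B \<omega> * Z \<omega>) powr p)"
  proof (rule integral_mono[OF int])
    show "integrable M (\<lambda>\<omega>. norm (X \<omega>) powr p + Re (g \<omega> * Z \<omega>) + 6 * norm (B \<omega> * Z \<omega>) powr p)"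
      by (intro Bochner_Integration.integrable_add iX integrable_Re igZ
          integrable_mult_right iBZ)
    have "Re (g \<omega> * Z \<omega>) = p * norm (X \<omega>) powr (p - 2) * Re (cnj (X \<omega>) * (B \<omega> * Z \<omega>))" for \<omega>
      unfolding g_def mult.assoc by (simp add: algebra_simps)
    then show "norm (X \<omega> + B \<omega> * Z \<omega>) powr p
        \<le> norm (X \<omega>) powr p + Re (g \<omega> * Z \<omega>) + 6 * norm (B \<omega> * Z \<omega>) powr p" for \<omega>
      using norm_add_powr_le[OF p, of "X \<omega>" "B \<omega> * Z \<omega>"] by simp
  qed
  also have "\<dots> = expectation (\<lambda>\<omega>. norm (X \<omega>) powr p) + expectation (\<lambda>\<omega>. Re (g \<omega> * Z \<omega>))
      + 6 * expectation (\<lambda>\<omega>. norm (B \<omega> * Z \<omega>) powr p)"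
    by (subst Bochner_Integration.integral_add Bochner_Integration.integral_mult_right,
        (intro Bochner_Integration.integrable_add iX integrable_Re igZ
          integrable_mult_right iBZ)+)+ simp
  also have "expectation (\<lambda>\<omega>. Re (g \<omega> * Z \<omega>)) = 0"
    using integral_Re[OF igZ] EgZ by simp
  finally show "expectation (\<lambda>\<omega>. norm (X \<omega> + B \<omega> * Z \<omega>) powr p)
      \<le> expectation (\<lambda>\<omega>. norm (X \<omega>) powr p)
        + 6 * (expectation (\<lambda>\<omega>. norm (B \<omega>) powr p) * expectation (\<lambda>\<omega>. norm (Z \<omega>) powr p))"
    unfolding EBZ by simp
qed

section \<open>Products along paths and sums over the tree\<close>

definition path_prod :: "('b list \<Rightarrow> 'w \<Rightarrow> 'c::comm_monoid_mult) \<Rightarrow> 'b list \<Rightarrow> 'w \<Rightarrow> 'c" where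
  "path_prod Y w \<omega> = (\<Prod>j=1..length w. Y (take j w) \<omega>)"

lemma path_prod_Nil [simp]: "path_prod Y [] \<omega> = 1"
  by (simp add: path_prod_def)

lemma path_prod_butlast:
  assumes "w \<noteq> []"
  shows "path_prod Y w \<omega> = path_prod Y (butlast w) \<omega> * Y w \<omega>"
proof -
  obtain n where n: "length w = Suc n" using assms by (cases w) auto
  have "take j (butlast w) = take j w" if "j \<le> n" for j
    using that n by (simp add: take_butlast)
  then show ?thesis unfolding path_prod_def using n by (simp add: prod.nat_ivl_Suc')
qed

text \<open>Prefixes of different lengths are different nodes, so the factors along a path are
  independent and the moment of their product is the product of their moments.\<close>

lemma (in prob_space) path_prod_moment:
  fixes Y :: "'b list \<Rightarrow> 'a \<Rightarrow> complex"
  assumes ind: "indep_vars (\<lambda>_. borel) Y I"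
    and sub: "\<And>j. j \<in> {1..length w} \<Longrightarrow> take j w \<in> I"
    and int: "\<And>v. v \<in> I \<Longrightarrow> integrable M (\<lambda>\<omega>. norm (Y v \<omega>) powr p)"
  shows "integrable M (\<lambda>\<omega>. norm (path_prod Y w \<omega>) powr p)"
    and "expectation (\<lambda>\<omega>. norm (path_prod Y w \<omega>) powr p)
      = (\<Prod>j=1..length w. expectation (\<lambda>\<omega>. norm (Y (take j w) \<omega>) powr p))"
proof -
  let ?J = "(\<lambda>j. take j w) ` {1..length w}"
  have inj: "inj_on (\<lambda>j. take j w) {1..length w}"
    by (rule inj_on_inverseI[where g = length]) auto
  have J: "?J \<subseteq> I" using sub by auto
  have "indep_vars (\<lambda>_. borel) (\<lambda>v \<omega>. norm (Y v \<omega>) powr p) ?J"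
    by (rule indep_vars_compose2[OF indep_vars_subset[OF ind J]]) measurable
  note * = _ this int[OF subsetD[OF J]]
  have eq: "norm (path_prod Y w \<omega>) powr p = (\<Prod>v\<in>?J. norm (Y v \<omega>) powr p)" for \<omega>
  proof -
    have "norm (path_prod Y w \<omega>) powr p = (\<Prod>j=1..length w. norm (Y (take j w) \<omega>) powr p)"
      unfolding path_prod_def by (simp add: prod_norm[symmetric] prod_powr_distrib)
    then show ?thesis by (simp only: prod.reindex[OF inj] comp_def)
  qed
  show "integrable M (\<lambda>\<omega>. norm (path_prod Y w \<omega>) powr p)"
    unfolding eq by (rule indep_vars_integrable[OF *]) auto
  have "expectation (\<lambda>\<omega>. norm (path_prod Y w \<omega>) powr p)
      = (\<Prod>v\<in>?J. expectation (\<lambda>\<omega>. norm (Y v \<omega>) powr p))"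
    unfolding eq by (rule indep_vars_lebesgue_integral[OF *]) auto
  then show "expectation (\<lambda>\<omega>. norm (path_prod Y w \<omega>) powr p)
      = (\<Prod>j=1..length w. expectation (\<lambda>\<omega>. norm (Y (take j w) \<omega>) powr p))"
    by (simp only: prod.reindex[OF inj] comp_def)
qed

text \<open>The summand of a longest word \<open>w\<close> is a function of the other variables times \<open>Y w - 1\<close>, which is
  centred and independent of them; so words are removed longest first.\<close>

lemma (in prob_space) tree_sum_moment:
  fixes Y :: "'b list \<Rightarrow> 'a \<Rightarrow> complex" and c :: "'b list \<Rightarrow> complex"
  assumes p: "1 \<le> p" "p \<le> 2"
    and "finite A"
    and "\<And>w. w \<in> A \<Longrightarrow> w \<noteq> []"
    and "\<And>w j. w \<in> A \<Longrightarrow> j \<in> {1..length w} \<Longrightarrow> take j w \<in> A"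
    and "indep_vars (\<lambda>_. borel) Y A"
    and "\<And>w. w \<in> A \<Longrightarrow> integrable M (\<lambda>\<omega>. norm (Y w \<omega>) powr p)"
    and "\<And>w. w \<in> A \<Longrightarrow> integrable M (\<lambda>\<omega>. norm (Y w \<omega> - 1) powr p)"
    and "\<And>w. w \<in> A \<Longrightarrow> has_bochner_integral M (Y w) 1"
  shows "integrable M (\<lambda>\<omega>. norm (\<Sum>w\<in>A. c w * path_prod Y (butlast w) \<omega> * (Y w \<omega> - 1)) powr p) \<and>
    expectation (\<lambda>\<omega>. norm (\<Sum>w\<in>A. c w * path_prod Y (butlast w) \<omega> * (Y w \<omega> - 1)) powr p)
    \<le> 6 * (\<Sum>w\<in>A. norm (c w) powr p * expectation (\<lambda>\<omega>. norm (path_prod Y (butlast w) \<omega>) powr p)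
        * expectation (\<lambda>\<omega>. norm (Y w \<omega> - 1) powr p))"
  using assms(3-)
proof (induction A rule: finite_psubset_induct)
  case (psubset A)
  note closed = psubset.prems(2) and ne = psubset.prems(1) and ind = psubset.prems(3)
  show ?case
  proof (cases "A = {}")
    case False
    have "\<exists>w\<in>A. \<forall>v\<in>A. length v \<le> length w"
    proof -
      have "Max (length ` A) \<in> length ` A"
        using psubset.hyps False by (intro Max_in) auto
      then obtain w where "w \<in> A" "length w = Max (length ` A)" by auto
      then show ?thesis using psubset.hyps by (intro bexI[of _ w]) auto
    qed
    then obtain w where w: "w \<in> A" and max: "\<And>v. v \<in> A \<Longrightarrow> length v \<le> length w" by blast
    define A' where "A' = A - {w}"
    have A: "A = insert w A'" "w \<notin> A'" "finite A'" "A' \<subset> A"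
      using w psubset.hyps by (auto simp: A'_def)
    \<comment> \<open>Proper prefixes are strictly shorter than the longest word \<open>w\<close>,
      hence survive its removal. This serves both for prefix closure of \<open>A'\<close> and for
      expressing the coefficient of \<open>Y w - 1\<close> through \<open>A'\<close> alone.\<close>
    have take_A': "take j v \<in> A'" if "v \<in> A" "j \<in> {1..length v - 1}" for v j
    proof -
      have "take j v \<in> A" using closed[OF that(1), of j] that(2) by auto
      moreover have "length (take j v) < length w" using max[OF that(1)] that(2) by auto
      ultimately show ?thesis by (auto simp: A'_def)
    qed
    have closed': "take j v \<in> A'" if "v \<in> A'" "j \<in> {1..length v}" for v j
    proof (cases "j = length v")
      case True then show ?thesis using that by simp
    next
      case False
      then show ?thesis using that A by (intro take_A') auto
    qed
    have bl: "take j (butlast v) = take j v" if "j \<in> {1..length v - 1}" for v :: "'b list" and j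
      using that by (intro take_butlast) auto
    define S where "S \<omega> = (\<Sum>v\<in>A'. c v * path_prod Y (butlast v) \<omega> * (Y v \<omega> - 1))" for \<omega>
    define B where "B \<omega> = c w * path_prod Y (butlast w) \<omega>" for \<omega>
    define Z where "Z \<omega> = Y w \<omega> - 1" for \<omega>
    have IH: "integrable M (\<lambda>\<omega>. norm (S \<omega>) powr p)"
      "expectation (\<lambda>\<omega>. norm (S \<omega>) powr p)
        \<le> 6 * (\<Sum>v\<in>A'. norm (c v) powr p * expectation (\<lambda>\<omega>. norm (path_prod Y (butlast v) \<omega>) powr p)
        * expectation (\<lambda>\<omega>. norm (Y v \<omega> - 1) powr p))"
      using psubset.IH[OF A(4) ne closed' indep_vars_subset[OF ind] psubset.prems(4) psubset.prems(5) psubset.prems(6)] A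
      unfolding S_def by auto
    \<comment> \<open>\<open>F\<close> and \<open>G\<close> present the remaining sum and the
      coefficient of \<open>Y w - 1\<close> as measurable functions of the family restricted to
      \<open>A'\<close>, the form in which independence from \<open>Y w\<close> is
      available.\<close>
    define F where "F f = (\<Sum>v\<in>A'. c v * (\<Prod>j=1..length v - 1. f (take j (butlast v))) * (f v - 1))"
      for f :: "'b list \<Rightarrow> complex"
    define G where "G f = c w * (\<Prod>j=1..length w - 1. f (take j (butlast w)))"
      for f :: "'b list \<Rightarrow> complex"
    let ?U = "\<lambda>\<omega>. restrict (\<lambda>i. Y i \<omega>) A'" and ?V = "\<lambda>\<omega>. restrict (\<lambda>i. Y i \<omega>) {w}"
    have ind': "indep_var (PiM A' (\<lambda>_. borel)) ?U (PiM {w} (\<lambda>_. borel)) ?V"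
      using A w by (intro indep_var_restrict[OF ind]) auto
    have F: "F \<in> borel_measurable (PiM A' (\<lambda>_. borel))"
      and G: "G \<in> borel_measurable (PiM A' (\<lambda>_. borel))"
      unfolding F_def G_def
      by (intro borel_measurable_sum borel_measurable_times borel_measurable_const
          borel_measurable_diff borel_measurable_prod measurable_component_singleton;
        use take_A' A w in \<open>auto simp: bl\<close>)+
    have H: "(\<lambda>f. f w - 1) \<in> borel_measurable (PiM {w} (\<lambda>_. borel :: complex measure))"
      by measurable
    have eqs: "F (?U \<omega>) = S \<omega>" "G (?U \<omega>) = B \<omega>" "?V \<omega> w - 1 = Z \<omega>" for \<omega>
      using A w by (auto simp: F_def G_def S_def B_def Z_def path_prod_def bl take_A'
          intro!: sum.cong prod.cong)
    have nB: "norm (B \<omega>) powr p = norm (c w) powr p * norm (path_prod Y (butlast w) \<omega>) powr p" for \<omega>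
      by (simp add: B_def norm_mult powr_mult)
    have iB: "integrable M (\<lambda>\<omega>. norm (B \<omega>) powr p)"
      unfolding nB
      by (intro integrable_mult_right path_prod_moment[OF ind] psubset.prems(4))
         (use take_A'[OF w] A in \<open>auto simp: bl\<close>)
    have iZ: "integrable M (\<lambda>\<omega>. norm (Z \<omega>) powr p)"
      using psubset.prems(5)[OF w] by (simp add: Z_def)
    have Z0: "has_bochner_integral M Z 0"
      using psubset.prems(6)[OF w] by (simp add: Z_def[abs_def] has_bochner_integral_iff prob_space)
    have sum_eq: "(\<Sum>w\<in>A. c w * path_prod Y (butlast w) \<omega> * (Y w \<omega> - 1)) = S \<omega> + B \<omega> * Z \<omega>" for \<omega>
      using A by (simp add: S_def B_def Z_def add.commute)
    show ?thesis
      unfolding sum_eq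
      using norm_add_moment_le[OF p ind' F G H, unfolded eqs, OF IH(1) iB iZ Z0] IH(2) A
      by (simp add: nB Z_def algebra_simps)
  qed auto
qed

section \<open>From pointwise moments to zeros\<close>

text \<open>Cauchy's formula on the circle of radius \<open>2 * r\<close>: points of the smaller
  disc stay at distance at least \<open>r\<close> from it, so the kernel is at most
  \<open>1 / r\<close>, the speed of the path is \<open>4 * pi * r\<close>, and division by
  \<open>2 * pi\<close> leaves the factor \<open>2\<close>.\<close>

lemma norm_le_circle_integral:
  fixes f :: "complex \<Rightarrow> complex"
  assumes "f holomorphic_on cball z (2 * r)" "w \<in> cball z r" "r > 0"
  shows "ennreal (norm (f w))
    \<le> 2 * (\<integral>\<^sup>+ t \<in> {0..1}. ennreal (norm (f (circlepath z (2 * r) t))) \<partial>lborel)"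
proof -
  let ?c = "circlepath z (2 * r)"
  define h where "h t = norm (f (?c t))" for t
  have c: "?c t \<in> cball z (2 * r)" for t
    using \<open>r > 0\<close> by (auto simp: circlepath dist_norm norm_mult)
  have cont: "continuous_on {0..1} h"
    unfolding h_def
    by (intro continuous_intros continuous_on_compose2[OF holomorphic_on_imp_continuous_on[OF assms(1)]])
       (use c in \<open>auto simp: circlepath intro!: continuous_intros\<close>)
  have "((\<lambda>u. f u / (u - w)) has_contour_integral (2 * of_real pi * \<i> * f w)) ?c"
    using assms by (intro Cauchy_integral_circlepath_simple) (auto simp: dist_norm norm_minus_commute)
  then have I: "((\<lambda>t. f (?c t) / (?c t - w) * vector_derivative ?c (at t))
      has_integral (2 * of_real pi * \<i> * f w)) {0..1}"
    by (simp add: has_contour_integral)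
  have int: "h integrable_on {0..1}"
    using cont by (rule integrable_continuous_real)
  have "norm (integral {0..1} (\<lambda>t. f (?c t) / (?c t - w) * vector_derivative ?c (at t)))
      \<le> integral {0..1} (\<lambda>t. 4 * pi * h t)"
  proof (rule integral_norm_bound_integral)
    show "(\<lambda>t. f (?c t) / (?c t - w) * vector_derivative ?c (at t)) integrable_on {0..1}"
      using I by blast
    show "(\<lambda>t. 4 * pi * h t) integrable_on {0..1}"
      using integrable_on_cmult_left[OF int, of "4 * pi"] by simp
    fix t :: real assume "t \<in> {0..1}"
    have "dist z (?c t) = 2 * r"
      using \<open>r > 0\<close> by (simp add: circlepath dist_norm norm_mult)
    then have "norm (?c t - w) \<ge> r"
      using assms(2) dist_triangle[of z "?c t" w] by (simp add: dist_norm norm_minus_commute)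
    moreover have "norm (vector_derivative ?c (at t)) = 4 * pi * r"
      using \<open>r > 0\<close> by (simp add: vector_derivative_circlepath norm_mult)
    ultimately show "norm (f (?c t) / (?c t - w) * vector_derivative ?c (at t)) \<le> 4 * pi * h t"
      using \<open>r > 0\<close>
      by (auto simp: norm_mult norm_divide h_def divide_simps mult.commute[of r] intro!: mult_left_mono)
  qed
  then have "2 * pi * norm (f w) \<le> 4 * pi * integral {0..1} h"
    using integral_unique[OF I] by (simp add: norm_mult)
  then have le: "norm (f w) \<le> 2 * integral {0..1} h" by simp
  have "(\<integral>\<^sup>+ t \<in> {0..1}. ennreal (h t) \<partial>lborel) = ennreal (integral {0..1} h)"
    using cont
    by (intro nn_integral_has_integral_lebesgue' integrable_integral int) (auto simp: h_def)
  then show ?thesis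
    using le by (simp add: h_def ennreal_leI flip: ennreal_numeral ennreal_mult')
qed

text \<open>On \<open>E\<close> twice the mean of the norm over the larger circle is at least
  \<open>1\<close>. Taking expectations and exchanging the integrals reduces a statement about some
  unknown point of the disc to first moments at fixed points.\<close>

lemma (in prob_space) prob_le_circle_mean:
  fixes f :: "complex \<Rightarrow> 'a \<Rightarrow> complex"
  assumes hol: "\<And>\<omega>. \<omega> \<in> space M \<Longrightarrow> (\<lambda>\<beta>. f \<beta> \<omega>) holomorphic_on UNIV"
    and [measurable]: "(\<lambda>(\<omega>, \<beta>). f \<beta> \<omega>) \<in> borel_measurable (M \<Otimes>\<^sub>M borel)"
    and "r > 0"
    and bound: "\<And>\<beta>. \<beta> \<in> cball z (2 * r) \<Longrightarrow> (\<integral>\<^sup>+ \<omega>. ennreal (norm (f \<beta> \<omega>)) \<partial>M) \<le> ennreal b"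
    and "b \<ge> 0"
    and E: "E \<in> events" "\<And>\<omega>. \<omega> \<in> E \<Longrightarrow> \<exists>\<beta>\<in>cball z r. norm (f \<beta> \<omega>) \<ge> 1"
  shows "prob E \<le> 2 * b"
proof -
  let ?c = "circlepath z (2 * r)"
  have [measurable]: "?c \<in> borel_measurable borel"
    unfolding circlepath by (intro borel_measurable_continuous_onI continuous_intros)
  have [measurable]: "E \<in> sets M" by fact
  have c: "?c t \<in> cball z (2 * r)" for t
    using \<open>r > 0\<close> by (auto simp: circlepath dist_norm norm_mult)
  let ?I = "\<lambda>\<omega>. \<integral>\<^sup>+ t \<in> {0..1}. ennreal (norm (f (?c t) \<omega>)) \<partial>lborel"
  have "emeasure M E = (\<integral>\<^sup>+ \<omega>. indicator E \<omega> \<partial>M)" by simp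
  also have "\<dots> \<le> (\<integral>\<^sup>+ \<omega>. 2 * ?I \<omega> \<partial>M)"
  proof (rule nn_integral_mono)
    fix \<omega> assume \<omega>: "\<omega> \<in> space M"
    show "indicator E \<omega> \<le> 2 * ?I \<omega>"
    proof (cases "\<omega> \<in> E")
      case True
      then obtain \<beta> where \<beta>: "\<beta> \<in> cball z r" "norm (f \<beta> \<omega>) \<ge> 1" using E by blast
      have "(1::ennreal) \<le> ennreal (norm (f \<beta> \<omega>))" using \<beta> by simp
      also have "\<dots> \<le> 2 * ?I \<omega>"
        using \<beta> \<open>r > 0\<close> by (intro norm_le_circle_integral holomorphic_on_subset[OF hol[OF \<omega>]]) auto
      finally show ?thesis using True by simp
    qed simp
  qed
  also have "\<dots> = 2 * (\<integral>\<^sup>+ \<omega>. ?I \<omega> \<partial>M)"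
    by (rule nn_integral_cmult) measurable
  \<comment> \<open>Tonelli's theorem; joint measurability in \<open>\<omega>\<close> and
    \<open>\<beta>\<close> enters here.\<close>
  also have "(\<integral>\<^sup>+ \<omega>. ?I \<omega> \<partial>M) = (\<integral>\<^sup>+ t. (\<integral>\<^sup>+ \<omega>. ennreal (norm (f (?c t) \<omega>)) * indicator {0..1} t \<partial>M) \<partial>lborel)"
  proof -
    interpret pair_sigma_finite M "lborel :: real measure" by unfold_locales
    show ?thesis by (rule Fubini'[symmetric]) measurable
  qed
  also have "\<dots> \<le> (\<integral>\<^sup>+ (t::real). ennreal b * indicator {0..1} t \<partial>lborel)"
  proof (rule nn_integral_mono)
    fix t :: real
    show "(\<integral>\<^sup>+ \<omega>. ennreal (norm (f (?c t) \<omega>)) * indicator {0..1} t \<partial>M) \<le> ennreal b * indicator {0..1} t"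
      using bound[OF c] by (cases "t \<in> {0..1}") auto
  qed
  also have "\<dots> = ennreal b" by (subst nn_integral_cmult_indicator) auto
  finally have "emeasure M E \<le> 2 * ennreal b" by (simp add: mult_left_mono)
  also have "\<dots> = ennreal (2 * b)"
    using \<open>b \<ge> 0\<close> by (simp add: ennreal_mult)
  finally show ?thesis
    using \<open>b \<ge> 0\<close> by (simp add: emeasure_eq_measure)
qed

text \<open>The exponent is \<open>p = 2\<close> if \<open>2 * \<bar>Re \<beta>\<bar> < \<sigma>\<^sub>1\<close> and \<open>p = \<sigma>\<^sub>1 / \<bar>Re \<beta>\<bar>\<close> otherwise; in the latter case the
  quantity below is \<open>p\<close> times \<open>(Im \<beta>)\<^sup>2 - (\<sigma>\<^sub>1 - \<bar>Re \<beta>\<bar>)\<^sup>2\<close>.\<close>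

lemma E1_exponent:
  assumes "\<beta> \<in> E1 a \<alpha>" and s: "grem_sigma a \<alpha> 1 > 0"
  obtains p where "1 < p" "p \<le> 2"
    "(p - 1) * (p * (Re \<beta>)\<^sup>2 - (grem_sigma a \<alpha> 1)\<^sup>2) + p * (Im \<beta>)\<^sup>2 < 0"
proof -
  define s where "s = grem_sigma a \<alpha> 1"
  have "open (E1 a \<alpha>)" unfolding E1_def by auto
  then obtain e where e: "e > 0" "ball \<beta> e \<subseteq> E1 a \<alpha>"
    using assms by (meson openE)
  have disj: "x \<notin> G1 a \<alpha>" "x \<notin> F1 a \<alpha>" if "x \<in> ball \<beta> e" for x
    using subsetD[OF e(2) that] closure_subset[of "G1 a \<alpha> \<union> F1 a \<alpha>"] unfolding E1_def by blast+
  define h where "h = e / 2"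
  have h: "0 < h" "h < e" using e by (auto simp: h_def)
  show ?thesis
  proof (cases "2 * \<bar>Re \<beta>\<bar> < s")
    case True
    \<comment> \<open>Moving the imaginary part away from zero stays inside the ball and keeps
      \<open>2 * \<bar>Re x\<bar> < s\<close>. The weak inequality from \<open>x\<close> lying
      outside \<open>F1\<close> thus becomes strict at \<open>\<beta>\<close>.\<close>
    define x where "x = Complex (Re \<beta>) (Im \<beta> + (if Im \<beta> \<ge> 0 then h else - h))"
    have "x - \<beta> = Complex 0 (if Im \<beta> \<ge> 0 then h else - h)" by (simp add: x_def complex_eq_iff)
    then have "norm (x - \<beta>) = h"
      using h by (simp add: complex_norm)
    then have "x \<in> ball \<beta> e"
      using h by (simp add: dist_norm norm_minus_commute)
    then have "x \<notin> F1 a \<alpha>" by (rule disj)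
    then have "2 * ((Re \<beta>)\<^sup>2 + (Im x)\<^sup>2) \<le> s\<^sup>2"
      using True by (auto simp: F1_def s_def x_def)
    moreover have "(Im \<beta>)\<^sup>2 < (Im x)\<^sup>2"
      using h by (intro power2_strict_mono) (auto simp: x_def)
    ultimately show ?thesis
      by (intro that[of 2]) (auto simp: s_def)
  next
    case False
    \<comment> \<open>Moving the real part away from zero makes
      \<open>2 * \<bar>Re x\<bar> > s\<close> even when
      \<open>2 * \<bar>Re \<beta>\<bar> = s\<close>, so being outside \<open>G1\<close> yields the
      other inequality, with the margin \<open>h\<close> at \<open>\<beta>\<close>.\<close>
    define x where "x = Complex (Re \<beta> + (if Re \<beta> \<ge> 0 then h else - h)) (Im \<beta>)"
    have "x - \<beta> = Complex (if Re \<beta> \<ge> 0 then h else - h) 0" by (simp add: x_def complex_eq_iff)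
    then have "norm (x - \<beta>) = h"
      using h by (simp add: complex_norm)
    then have "x \<in> ball \<beta> e"
      using h by (simp add: dist_norm norm_minus_commute)
    then have "x \<notin> G1 a \<alpha>" by (rule disj)
    moreover have absx: "\<bar>Re x\<bar> = \<bar>Re \<beta>\<bar> + h" using h by (auto simp: x_def)
    ultimately have "\<bar>Re \<beta>\<bar> + h + \<bar>Im \<beta>\<bar> \<le> s"
      using False h by (auto simp: G1_def s_def x_def)
    define \<sigma> where "\<sigma> = \<bar>Re \<beta>\<bar>"
    have \<sigma>: "\<sigma> > 0" "\<sigma> < s" "s \<le> 2 * \<sigma>" "\<bar>Im \<beta>\<bar> < s - \<sigma>"
      using \<open>\<bar>Re \<beta>\<bar> + h + \<bar>Im \<beta>\<bar> \<le> s\<close> h False s by (auto simp: \<sigma>_def s_def)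
    have "(Im \<beta>)\<^sup>2 < (s - \<sigma>)\<^sup>2" using \<sigma> by (intro power2_strict_mono) auto
    then have "s / \<sigma> * (Im \<beta>)\<^sup>2 < s / \<sigma> * (s - \<sigma>)\<^sup>2"
      using \<sigma> by (intro mult_strict_left_mono) auto
    moreover have "(s / \<sigma> - 1) * (s / \<sigma> * \<sigma>\<^sup>2 - s\<^sup>2) = - (s / \<sigma> * (s - \<sigma>)\<^sup>2)"
      using \<sigma> by (simp add: field_simps power2_eq_square)
    ultimately have "(s / \<sigma> - 1) * (s / \<sigma> * (Re \<beta>)\<^sup>2 - s\<^sup>2) + s / \<sigma> * (Im \<beta>)\<^sup>2 < 0"
      by (simp add: \<sigma>_def)
    then show ?thesis
      using \<sigma> by (intro that[of "s / \<sigma>"]) (auto simp: s_def field_simps)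
  qed
qed

section \<open>The normalised partition function\<close>

lemma grem_words_0 [simp]: "grem_words N n 0 = {[]}"
  by (auto simp: grem_words_def)

lemma grem_words_Suc:
  "grem_words N n (Suc k) = (\<lambda>(v, x). v @ [x]) ` (grem_words N n k \<times> {1..N n (Suc k)})"
proof safe
  fix w assume w: "w \<in> grem_words N n (Suc k)"
  then have ne: "w \<noteq> []" and len: "length w = Suc k" by (auto simp: grem_words_def)
  have "1 \<le> butlast w ! (i - 1) \<and> butlast w ! (i - 1) \<le> N n i" if "i \<in> {1..k}" for i
  proof -
    have "butlast w ! (i - 1) = w ! (i - 1)" using that len by (intro nth_butlast) auto
    then show ?thesis using w that by (simp add: grem_words_def)
  qed
  then have "butlast w \<in> grem_words N n k"
    using len by (simp add: grem_words_def)
  moreover have "last w \<in> {1..N n (Suc k)}"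
    using w ne len by (auto simp: grem_words_def last_conv_nth dest!: bspec[of _ _ "Suc k"])
  ultimately show "w \<in> (\<lambda>(v, x). v @ [x]) ` (grem_words N n k \<times> {1..N n (Suc k)})"
    using ne by (intro image_eqI[of _ _ "(butlast w, last w)"]) auto
next
  fix v x assume v: "v \<in> grem_words N n k" and x: "x \<in> {1..N n (Suc k)}"
  have "1 \<le> (v @ [x]) ! (i - 1) \<and> (v @ [x]) ! (i - 1) \<le> N n i" if "i \<in> {1..Suc k}" for i
  proof (cases "i = Suc k")
    case True
    then show ?thesis using v x by (simp add: grem_words_def nth_append)
  next
    case False
    then have "i \<in> {1..k}" using that by auto
    moreover from this have "i - 1 < k" by auto
    ultimately show ?thesis using v by (simp add: grem_words_def nth_append)
  qed
  then show "v @ [x] \<in> grem_words N n (Suc k)"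
    using v by (simp add: grem_words_def)
qed

lemma sum_grem_words_Suc:
  "(\<Sum>w\<in>grem_words N n (Suc k). f w) = (\<Sum>v\<in>grem_words N n k. \<Sum>x=1..N n (Suc k). f (v @ [x]))"
proof -
  have "inj_on (\<lambda>(v, x). v @ [x]) (grem_words N n k \<times> {1..N n (Suc k)})"
    by (auto simp: inj_on_def)
  then show ?thesis
    unfolding grem_words_Suc
    by (simp add: sum.reindex case_prod_unfold sum.cartesian_product)
qed

lemma length_grem_words: "w \<in> grem_words N n k \<Longrightarrow> length w = k"
  by (simp add: grem_words_def)

lemma finite_grem_words [simp]: "finite (grem_words N n k)"
  by (induction k) (auto simp: grem_words_Suc)

lemma card_grem_words: "card (grem_words N n k) = (\<Prod>j=1..k. N n j)"
proof (induction k)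
  case (Suc k)
  have "card (grem_words N n (Suc k)) = card (grem_words N n k) * N n (Suc k)"
    using sum_grem_words_Suc[of "\<lambda>_. 1 :: nat" N n k] by simp
  then show ?case using Suc by (simp add: prod.nat_ivl_Suc')
qed simp

lemma take_grem_words:
  assumes "w \<in> grem_words N n k" "j \<le> k"
  shows "take j w \<in> grem_words N n j"
  using assms by (auto simp: grem_words_def)

lemma finite_grem_index [simp]: "finite (grem_index d N n)"
  by (simp add: grem_index_def)

lemma grem_index_length:
  assumes "w \<in> grem_index d N n"
  shows "length w \<in> {1..d}" "w \<in> grem_words N n (length w)"
  using assms by (auto simp: grem_index_def length_grem_words)

lemma take_grem_index:
  assumes "w \<in> grem_words N n k" "k \<le> d" "j \<in> {1..k}"
  shows "take j w \<in> grem_index d N n"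
  using take_grem_words[OF assms(1), of j] assms by (auto simp: grem_index_def)

lemma sum_grem_index:
  "(\<Sum>w\<in>grem_index d N n. f w) = (\<Sum>k=1..d. \<Sum>w\<in>grem_words N n k. f w)"
  unfolding grem_index_def
  by (intro sum.UNION_disjoint) (auto dest: length_grem_words)

text \<open>The averages over consecutive levels telescope, starting from the value \<open>1\<close>
  at the root. Each word has the same number of children on a given level, so averaging the parent's
  product over the children gives back the average over the parent level, and a child minus its
  parent is the parent's product times \<open>Y w - 1\<close>.\<close>

lemma grem_telescope:
  fixes Y :: "nat list \<Rightarrow> 'w \<Rightarrow> complex"
  assumes "\<And>j. j \<in> {1..d} \<Longrightarrow> N n j > 0"
  shows "(\<Sum>w\<in>grem_words N n d. path_prod Y w \<omega>) / of_nat (\<Prod>j=1..d. N n j) - 1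
    = (\<Sum>w\<in>grem_index d N n. (1 / of_nat (\<Prod>j=1..length w. N n j)) * path_prod Y (butlast w) \<omega> * (Y w \<omega> - 1))"
  using assms
proof (induction d)
  case 0
  then show ?case by (simp add: grem_index_def)
next
  case (Suc k)
  define L where "L k = (of_nat (\<Prod>j=1..k. N n j) :: complex)" for k
  define S where "S k = (\<Sum>w\<in>grem_words N n k. path_prod Y w \<omega>)" for k
  have L: "L (Suc k) = L k * of_nat (N n (Suc k))" "of_nat (N n (Suc k)) \<noteq> (0::complex)"
    using Suc.prems by (auto simp: L_def prod.nat_ivl_Suc')
  have "(\<Sum>w\<in>grem_words N n (Suc k). (1 / L (length w)) * path_prod Y (butlast w) \<omega> * (Y w \<omega> - 1))
    = (\<Sum>w\<in>grem_words N n (Suc k). (1 / L (Suc k)) * (path_prod Y w \<omega> - path_prod Y (butlast w) \<omega>))"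
  proof (intro sum.cong refl)
    fix w assume w: "w \<in> grem_words N n (Suc k)"
    then have "w \<noteq> []" by (auto simp: grem_words_def)
    then show "(1 / L (length w)) * path_prod Y (butlast w) \<omega> * (Y w \<omega> - 1)
        = (1 / L (Suc k)) * (path_prod Y w \<omega> - path_prod Y (butlast w) \<omega>)"
      using path_prod_butlast[of w Y \<omega>] length_grem_words[OF w]
      by (simp add: algebra_simps diff_divide_distrib)
  qed
  also have "\<dots> = (1 / L (Suc k)) * (S (Suc k) - (\<Sum>w\<in>grem_words N n (Suc k). path_prod Y (butlast w) \<omega>))"
    by (simp only: sum_distrib_left[symmetric] sum_subtractf S_def)
  also have "(\<Sum>w\<in>grem_words N n (Suc k). path_prod Y (butlast w) \<omega>) = of_nat (N n (Suc k)) * S k"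
    by (simp add: sum_grem_words_Suc S_def sum_distrib_left)
  also have "(1 / L (Suc k)) * (S (Suc k) - of_nat (N n (Suc k)) * S k) = S (Suc k) / L (Suc k) - S k / L k"
    using L by (simp add: diff_divide_distrib)
  finally have "(\<Sum>w\<in>grem_words N n (Suc k). (1 / L (length w)) * path_prod Y (butlast w) \<omega> * (Y w \<omega> - 1))
    = S (Suc k) / L (Suc k) - S k / L k" .
  note A = this
  have B: "S k / L k - 1 = (\<Sum>w\<in>grem_index k N n. (1 / L (length w)) * path_prod Y (butlast w) \<omega> * (Y w \<omega> - 1))"
    using Suc unfolding S_def L_def by simp
  have split: "(\<Sum>w\<in>grem_index (Suc k) N n. g w) = (\<Sum>w\<in>grem_index k N n. g w)
      + (\<Sum>w\<in>grem_words N n (Suc k). g w)" for g :: "nat list \<Rightarrow> complex"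
    by (simp add: sum_grem_index)
  have "S (Suc k) / L (Suc k) - 1
      = (\<Sum>w\<in>grem_index (Suc k) N n. (1 / L (length w)) * path_prod Y (butlast w) \<omega> * (Y w \<omega> - 1))"
    unfolding split A B[symmetric] by (simp add: algebra_simps)
  then show ?case unfolding S_def L_def .
qed

section \<open>The Gaussian factors and their moments\<close>

text \<open>The factor that a node contributes to the partition function, divided by its
  expectation; the latter is the inverse of the first exponential.\<close>

definition grem_Y :: "(nat \<Rightarrow> real) \<Rightarrow> nat \<Rightarrow> (nat list \<Rightarrow> 'w \<Rightarrow> real) \<Rightarrow> complex \<Rightarrow> nat list \<Rightarrow> 'w \<Rightarrow> complex" where
  "grem_Y a n \<xi> \<beta> w \<omega> = exp (- (\<beta>\<^sup>2 * of_real (real n * a (length w) / 2)))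
     * exp (\<beta> * of_real (sqrt (real n) * sqrt (a (length w))) * of_real (\<xi> w \<omega>))"

text \<open>The normalising constants along a path depend only on the levels, so their product is
  common to all words. It never vanishes, so zeros are exactly those of the sum of path
  products.\<close>

lemma grem_Z_eq:
  "grem_Z d a N \<xi> n \<beta> \<omega> = exp (\<beta>\<^sup>2 * of_real (real n * (\<Sum>j=1..d. a j) / 2))
     * (\<Sum>w\<in>grem_words N n d. path_prod (grem_Y a n (\<xi> n) \<beta>) w \<omega>)"
proof -
  have "exp (\<beta> * of_real (sqrt (real n)) * of_real (grem_X d a (\<xi> n) w \<omega>))
      = exp (\<beta>\<^sup>2 * of_real (real n * (\<Sum>j=1..d. a j) / 2)) * path_prod (grem_Y a n (\<xi> n) \<beta>) w \<omega>"
    if "w \<in> grem_words N n d" for w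
  proof -
    have "path_prod (grem_Y a n (\<xi> n) \<beta>) w \<omega> = (\<Prod>j=1..d. exp (- (\<beta>\<^sup>2 * of_real (real n * a j / 2))
        + \<beta> * of_real (sqrt (real n) * sqrt (a j)) * of_real (\<xi> n (take j w) \<omega>)))"
      unfolding path_prod_def grem_Y_def mult_exp_exp
      using length_grem_words[OF that] by (intro prod.cong) auto
    also have "\<dots> = exp (\<Sum>j=1..d. - (\<beta>\<^sup>2 * of_real (real n * a j / 2))
        + \<beta> * of_real (sqrt (real n) * sqrt (a j)) * of_real (\<xi> n (take j w) \<omega>))"
      by (simp add: exp_sum)
    also have "(\<Sum>j=1..d. - (\<beta>\<^sup>2 * of_real (real n * a j / 2))
        + \<beta> * of_real (sqrt (real n) * sqrt (a j)) * of_real (\<xi> n (take j w) \<omega>))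
      = - (\<beta>\<^sup>2 * of_real (real n * (\<Sum>j=1..d. a j) / 2))
        + \<beta> * of_real (sqrt (real n)) * of_real (grem_X d a (\<xi> n) w \<omega>)"
      unfolding sum.distrib sum_negf grem_X_def sum_distrib_left sum_divide_distrib of_real_sum
      by (simp add: mult.assoc)
    finally show ?thesis
      by (simp add: mult_exp_exp)
  qed
  then show ?thesis
    by (simp add: grem_Z_def grem_states_def sum_distrib_left)
qed

lemma (in prob_space) grem_Y_mean:
  assumes "distributed M lborel (\<xi> w) std_normal_density" "a (length w) \<ge> 0"
  shows "has_bochner_integral M (grem_Y a n \<xi> \<beta> w) 1"
proof -
  let ?z = "\<beta> * of_real (sqrt (real n) * sqrt (a (length w)))"
  have "has_bochner_integral M (grem_Y a n \<xi> \<beta> w)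
      (exp (- (\<beta>\<^sup>2 * of_real (real n * a (length w) / 2))) * exp (?z\<^sup>2 / 2))"
    unfolding grem_Y_def[abs_def]
    by (intro has_bochner_integral_mult_right has_integral_exp_std_normal assms)
  moreover have "?z\<^sup>2 / 2 = \<beta>\<^sup>2 * of_real (real n * a (length w) / 2)"
    using assms by (simp add: power_mult_distrib flip: of_real_power)
  ultimately show ?thesis by (simp add: mult_exp_exp)
qed

text \<open>With \<open>A = n * a\<close>, the Gaussian exponential contributes the exponent
  \<open>p\<^sup>2 * (Re \<beta>)\<^sup>2 * A / 2\<close> and the normalisation contributes
  \<open>- p * ((Re \<beta>)\<^sup>2 - (Im \<beta>)\<^sup>2) * A / 2\<close>.\<close>

lemma (in prob_space) grem_Y_moment:
  assumes "distributed M lborel (\<xi> w) std_normal_density" "a (length w) \<ge> 0"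
  shows "has_bochner_integral M (\<lambda>\<omega>. norm (grem_Y a n \<xi> \<beta> w \<omega>) powr p)
    (exp (real n * a (length w) / 2 * (p * (p - 1) * (Re \<beta>)\<^sup>2 + p * (Im \<beta>)\<^sup>2)))"
proof -
  let ?A = "real n * a (length w)"
  let ?z = "\<beta> * of_real (sqrt (real n) * sqrt (a (length w)))"
  have "norm (grem_Y a n \<xi> \<beta> w \<omega>) powr p
      = exp (- p * ((Re \<beta>)\<^sup>2 - (Im \<beta>)\<^sup>2) * ?A / 2) * norm (exp (?z * of_real (\<xi> w \<omega>))) powr p" for \<omega>
    unfolding grem_Y_def norm_mult
    by (subst powr_mult) (simp_all add: powr_def Re_power2)
  moreover have "has_bochner_integral M
      (\<lambda>\<omega>. exp (- p * ((Re \<beta>)\<^sup>2 - (Im \<beta>)\<^sup>2) * ?A / 2) * norm (exp (?z * of_real (\<xi> w \<omega>))) powr p)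
      (exp (- p * ((Re \<beta>)\<^sup>2 - (Im \<beta>)\<^sup>2) * ?A / 2) * exp ((p * Re ?z)\<^sup>2 / 2))"
    by (intro has_bochner_integral_mult_right has_integral_norm_exp_std_normal assms)
  moreover have "(Re ?z)\<^sup>2 = (Re \<beta>)\<^sup>2 * ?A"
    using assms by (simp add: power_mult_distrib)
  then have "- p * ((Re \<beta>)\<^sup>2 - (Im \<beta>)\<^sup>2) * ?A / 2 + (p * Re ?z)\<^sup>2 / 2
      = ?A / 2 * (p * (p - 1) * (Re \<beta>)\<^sup>2 + p * (Im \<beta>)\<^sup>2)"
    unfolding power_mult_distrib by (simp add: field_simps power2_eq_square)
  ultimately show ?thesis by (simp only: mult_exp_exp)
qed

lemma (in prob_space) grem_Y_centred_moment:
  assumes "distributed M lborel (\<xi> w) std_normal_density" "a (length w) \<ge> 0" "1 \<le> p" "p \<le> 2"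
  shows "integrable M (\<lambda>\<omega>. norm (grem_Y a n \<xi> \<beta> w \<omega> - 1) powr p)"
    and "expectation (\<lambda>\<omega>. norm (grem_Y a n \<xi> \<beta> w \<omega> - 1) powr p)
      \<le> 8 * expectation (\<lambda>\<omega>. norm (grem_Y a n \<xi> \<beta> w \<omega>) powr p)"
proof -
  let ?Y = "grem_Y a n \<xi> \<beta> w"
  note m = grem_Y_moment[where \<xi> = \<xi> and a = a and w = w, OF assms(1,2), of n \<beta> p]
  have int: "integrable M (\<lambda>\<omega>. norm (?Y \<omega>) powr p)"
    using m by (simp add: has_bochner_integral_iff)
  have [measurable]: "?Y \<in> borel_measurable M"
    using grem_Y_mean[where \<xi> = \<xi> and a = a and w = w, OF assms(1,2), of n \<beta>]
    by (auto simp: has_bochner_integral_iff)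
  have le: "norm (?Y \<omega> - 1) powr p \<le> 4 * (norm (?Y \<omega>) powr p + 1)" for \<omega>
    using powr_add_le[of "norm (?Y \<omega>)" 1 p] assms
      powr_mono2[of p "norm (?Y \<omega> - 1)" "norm (?Y \<omega>) + 1"] norm_triangle_ineq4[of "?Y \<omega>" 1]
    by simp
  show i: "integrable M (\<lambda>\<omega>. norm (?Y \<omega> - 1) powr p)"
    by (rule Bochner_Integration.integrable_bound[of M "\<lambda>\<omega>. 4 * (norm (?Y \<omega>) powr p + 1)"])
       (use int le in auto)
  have "expectation (\<lambda>\<omega>. norm (?Y \<omega> - 1) powr p) \<le> expectation (\<lambda>\<omega>. 4 * (norm (?Y \<omega>) powr p + 1))"
    by (rule integral_mono[OF i]) (use int le in auto)
  also have "\<dots> = 4 * (expectation (\<lambda>\<omega>. norm (?Y \<omega>) powr p) + 1)"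
    using int by (simp add: prob_space)
  \<comment> \<open>The exponent of the moment is nonnegative for \<open>p \<ge> 1\<close>, so the
    constant \<open>1\<close> is absorbed and \<open>4\<close> doubles to \<open>8\<close>.\<close>
  also have "1 \<le> expectation (\<lambda>\<omega>. norm (?Y \<omega>) powr p)"
    using m assms by (simp add: has_bochner_integral_iff)
  finally show "expectation (\<lambda>\<omega>. norm (?Y \<omega> - 1) powr p) \<le> 8 * expectation (\<lambda>\<omega>. norm (?Y \<omega>) powr p)"
    by simp
qed

text \<open>The uncountable existential is traded for a countable one: by continuity and compactness
  a zero exists iff the norm gets arbitrarily small on a countable dense subset of
  \<open>K\<close>.\<close>

lemma sets_zero_set:
  fixes f :: "'b::{metric_space, second_countable_topology} \<Rightarrow> 'a \<Rightarrow> complex"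
  assumes K: "compact K"
    and cont: "\<And>\<omega>. \<omega> \<in> space M \<Longrightarrow> continuous_on K (\<lambda>\<beta>. f \<beta> \<omega>)"
    and meas: "\<And>\<beta>. \<beta> \<in> K \<Longrightarrow> f \<beta> \<in> borel_measurable M"
  shows "{\<omega> \<in> space M. \<exists>\<beta>\<in>K. f \<beta> \<omega> = 0} \<in> sets M"
proof -
  obtain T where T: "countable T" "T \<subseteq> K" "K \<subseteq> closure T"
    by (rule separable)
  have "{\<omega> \<in> space M. \<exists>\<beta>\<in>K. f \<beta> \<omega> = 0}
      = {\<omega> \<in> space M. \<forall>m::nat. \<exists>\<beta>\<in>T. norm (f \<beta> \<omega>) < 1 / Suc m}"
  proof (intro Collect_cong conj_cong refl iffI)
    fix \<omega> assume \<omega>: "\<omega> \<in> space M" and "\<exists>\<beta>\<in>K. f \<beta> \<omega> = 0"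
    then obtain \<beta> where \<beta>: "\<beta> \<in> K" "f \<beta> \<omega> = 0" by blast
    show "\<forall>m::nat. \<exists>\<beta>\<in>T. norm (f \<beta> \<omega>) < 1 / Suc m"
    proof
      fix m :: nat
      obtain e where e: "e > 0" "\<And>x. x \<in> K \<Longrightarrow> dist x \<beta> < e \<Longrightarrow> dist (f x \<omega>) (f \<beta> \<omega>) < 1 / Suc m"
        using cont[OF \<omega>] \<beta>(1) unfolding continuous_on_iff
        by (metis of_nat_0_less_iff zero_less_Suc zero_less_divide_1_iff)
      obtain x where "x \<in> T" "dist x \<beta> < e"
        using T(3) \<beta>(1) e(1) closure_approachable by blast
      then show "\<exists>\<beta>\<in>T. norm (f \<beta> \<omega>) < 1 / Suc m"
        using e(2)[of x] T(2) \<beta>(2) by (intro bexI[of _ x]) auto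
    qed
  next
    fix \<omega> assume \<omega>: "\<omega> \<in> space M" and *: "\<forall>m::nat. \<exists>\<beta>\<in>T. norm (f \<beta> \<omega>) < 1 / Suc m"
    then have "K \<noteq> {}" using T(2) by blast
    then obtain \<beta> where \<beta>: "\<beta> \<in> K" "\<And>x. x \<in> K \<Longrightarrow> norm (f \<beta> \<omega>) \<le> norm (f x \<omega>)"
      using continuous_attains_inf[OF K _ continuous_on_norm[OF cont[OF \<omega>]]] by blast
    have "f \<beta> \<omega> = 0"
    proof (rule ccontr)
      assume "f \<beta> \<omega> \<noteq> 0"
      then obtain m where "inverse (real (Suc m)) < norm (f \<beta> \<omega>)"
        using reals_Archimedean[of "norm (f \<beta> \<omega>)"] by auto
      moreover obtain x where "x \<in> T" "norm (f x \<omega>) < 1 / Suc m" using * by blast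
      ultimately show False using \<beta>(2)[of x] T(2) by (auto simp: inverse_eq_divide)
    qed
    then show "\<exists>\<beta>\<in>K. f \<beta> \<omega> = 0" using \<beta>(1) by blast
  qed
  also have "\<dots> \<in> sets M"
  proof (intro sets.sets_Collect_countable_All sets.sets_Collect_countable_Ex' T)
    fix m \<beta> assume "\<beta> \<in> T"
    then have [measurable]: "f \<beta> \<in> borel_measurable M" using meas T by auto
    show "{\<omega> \<in> space M. norm (f \<beta> \<omega>) < 1 / Suc m} \<in> sets M" by measurable
  qed
  finally show ?thesis .
qed

text \<open>The tree inequality is applied to the telescoped sum. Level \<open>k\<close> has
  \<open>L k\<close> words, each weighted by \<open>L k powr (- p)\<close>, which together give
  \<open>L k powr (1 - p)\<close>. The constant is \<open>6\<close> from the tree inequality times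
  \<open>8\<close> from centring.\<close>

lemma (in prob_space) grem_moment_le:
  fixes \<xi> :: "nat list \<Rightarrow> 'a \<Rightarrow> real" and \<beta> :: complex
  assumes p: "1 \<le> p" "p \<le> 2"
    and a: "\<And>j. j \<in> {1..d} \<Longrightarrow> a j > 0"
    and N: "\<And>j. j \<in> {1..d} \<Longrightarrow> N n j > 0"
    and ind: "indep_vars (\<lambda>_. borel) \<xi> (grem_index d N n)"
    and dist: "\<And>w. w \<in> grem_index d N n \<Longrightarrow> distributed M lborel (\<xi> w) std_normal_density"
  defines "f \<equiv> \<lambda>\<omega>. (\<Sum>w\<in>grem_words N n d. path_prod (grem_Y a n \<xi> \<beta>) w \<omega>) / of_nat (\<Prod>j=1..d. N n j) - 1"
  shows "integrable M (\<lambda>\<omega>. norm (f \<omega>) powr p)"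
    and "expectation (\<lambda>\<omega>. norm (f \<omega>) powr p) \<le> 48 * (\<Sum>k=1..d. \<Prod>j=1..k. real (N n j) powr (1 - p)
      * exp (real n * a j / 2 * (p * (p - 1) * (Re \<beta>)\<^sup>2 + p * (Im \<beta>)\<^sup>2)))"
proof -
  let ?I = "grem_index d N n" and ?Y = "grem_Y a n \<xi> \<beta>"
  define e where "e j = exp (real n * a j / 2 * (p * (p - 1) * (Re \<beta>)\<^sup>2 + p * (Im \<beta>)\<^sup>2))" for j
  define L where "L k = real (\<Prod>j=1..k. N n j)" for k
  define c where "c w = (1 / of_nat (\<Prod>j=1..length w. N n j) :: complex)" for w :: "nat list"
  have a0: "a (length w) \<ge> 0" if "w \<in> ?I" for w
    using a[of "length w"] grem_index_length(1)[OF that] by (simp add: less_imp_le)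
  have mom: "has_bochner_integral M (\<lambda>\<omega>. norm (?Y w \<omega>) powr p) (e (length w))" if "w \<in> ?I" for w
    unfolding e_def using dist[OF that] a0[OF that] by (rule grem_Y_moment)
  then have EY: "expectation (\<lambda>\<omega>. norm (?Y w \<omega>) powr p) = e (length w)"
    and iY: "integrable M (\<lambda>\<omega>. norm (?Y w \<omega>) powr p)" if "w \<in> ?I" for w
    using that by (auto simp: has_bochner_integral_iff)
  have indY: "indep_vars (\<lambda>_. borel) ?Y ?I"
    unfolding grem_Y_def[abs_def] by (rule indep_vars_compose2[OF ind]) measurable
  have take: "take j w \<in> ?I" if "w \<in> ?I" "j \<in> {1..length w}" for w j
    using grem_index_length[OF that(1)] that(2) by (intro take_grem_index) auto
  have ne: "w \<noteq> []" if "w \<in> ?I" for w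
    using grem_index_length(1)[OF that] by auto
  have f: "f \<omega> = (\<Sum>w\<in>?I. c w * path_prod ?Y (butlast w) \<omega> * (?Y w \<omega> - 1))" for \<omega>
    unfolding f_def c_def by (rule grem_telescope) (use N in auto)
  have iY1: "integrable M (\<lambda>\<omega>. norm (?Y w \<omega> - 1) powr p)" if "w \<in> ?I" for w
    using dist[OF that] a0[OF that] p by (rule grem_Y_centred_moment(1))
  have mean: "has_bochner_integral M (?Y w) 1" if "w \<in> ?I" for w
    using dist[OF that] a0[OF that] by (rule grem_Y_mean)
  note tree = tree_sum_moment[where c = c, OF p finite_grem_index ne take indY iY iY1 mean]
  show "integrable M (\<lambda>\<omega>. norm (f \<omega>) powr p)"
    unfolding f using tree by blast
  have summand_le: "norm (c w) powr p * expectation (\<lambda>\<omega>. norm (path_prod ?Y (butlast w) \<omega>) powr p)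
        * expectation (\<lambda>\<omega>. norm (?Y w \<omega> - 1) powr p)
      \<le> 8 * (L k powr (- p) * (\<Prod>j=1..k. e j))" if "k \<in> {1..d}" "w \<in> grem_words N n k" for w k
  proof -
    have w: "w \<in> ?I" using that by (auto simp: grem_index_def)
    have k: "length w = k" using that by (simp add: length_grem_words)
    have "k \<noteq> 0" using that(1) by simp
    then obtain k' where k': "k = Suc k'" by (cases k) auto
    have tb: "take j (butlast w) = take j w" if "j \<in> {1..k'}" for j
      using that k k' by (intro take_butlast) auto
    have "norm (c w) powr p = L k powr (- p)"
      by (simp add: c_def L_def k norm_divide powr_divide powr_minus inverse_eq_divide del: of_nat_prod)
    moreover have "expectation (\<lambda>\<omega>. norm (path_prod ?Y (butlast w) \<omega>) powr p) = (\<Prod>j=1..k'. e j)"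
    proof -
      have "expectation (\<lambda>\<omega>. norm (path_prod ?Y (butlast w) \<omega>) powr p)
          = (\<Prod>j=1..length (butlast w). expectation (\<lambda>\<omega>. norm (?Y (take j (butlast w)) \<omega>) powr p))"
        by (rule path_prod_moment(2)[OF indY _ iY]) (use take[OF w] k k' tb in auto)
      also have "\<dots> = (\<Prod>j=1..k'. e j)"
      proof (intro prod.cong)
        fix j assume j: "j \<in> {1..k'}"
        then have "take j w \<in> ?I" "length (take j w) = j" using take[OF w] k k' by auto
        then show "expectation (\<lambda>\<omega>. norm (?Y (take j (butlast w)) \<omega>) powr p) = e j"
          using EY tb[OF j] by simp
      qed (use k k' in auto)
      finally show ?thesis .
    qed
    moreover have "expectation (\<lambda>\<omega>. norm (?Y w \<omega> - 1) powr p) \<le> 8 * e k"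
      using grem_Y_centred_moment(2)[where \<xi> = \<xi> and a = a and w = w, OF dist[OF w] a0[OF w] p, of n \<beta>] EY[OF w] k by simp
    moreover have "(\<Prod>j=1..k'. e j) \<ge> 0" by (intro prod_nonneg) (simp add: e_def)
    ultimately have "norm (c w) powr p * expectation (\<lambda>\<omega>. norm (path_prod ?Y (butlast w) \<omega>) powr p)
        * expectation (\<lambda>\<omega>. norm (?Y w \<omega> - 1) powr p) \<le> L k powr (- p) * (\<Prod>j=1..k'. e j) * (8 * e k)"
      by (simp add: mult_left_mono)
    then show ?thesis by (simp add: k' prod.nat_ivl_Suc' mult_ac)
  qed
  have level: "(\<Sum>w\<in>grem_words N n k. 8 * (L k powr (- p) * (\<Prod>j=1..k. e j)))
      = 8 * (\<Prod>j=1..k. real (N n j) powr (1 - p) * e j)" if "k \<in> {1..d}" for k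
  proof -
    have "L k > 0" unfolding L_def using N that by (auto intro!: prod_pos)
    have "(\<Sum>w\<in>grem_words N n k. 8 * (L k powr (- p) * (\<Prod>j=1..k. e j)))
        = 8 * (L k * L k powr (- p)) * (\<Prod>j=1..k. e j)"
      by (simp add: card_grem_words L_def)
    also have "L k * L k powr (- p) = L k powr (1 - p)"
      using \<open>L k > 0\<close> by (simp add: powr_diff powr_minus divide_inverse)
    also have "\<dots> = (\<Prod>j=1..k. real (N n j) powr (1 - p))"
      by (simp add: L_def prod_powr_distrib)
    finally show ?thesis by (simp add: prod.distrib)
  qed
  have "expectation (\<lambda>\<omega>. norm (f \<omega>) powr p)
      \<le> 6 * (\<Sum>w\<in>?I. norm (c w) powr p * expectation (\<lambda>\<omega>. norm (path_prod ?Y (butlast w) \<omega>) powr p)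
        * expectation (\<lambda>\<omega>. norm (?Y w \<omega> - 1) powr p))"
    unfolding f using tree by blast
  also have "\<dots> \<le> 6 * (\<Sum>k=1..d. \<Sum>w\<in>grem_words N n k. 8 * (L k powr (- p) * (\<Prod>j=1..k. e j)))"
    unfolding sum_grem_index by (intro mult_left_mono sum_mono summand_le) auto
  also have "\<dots> = 6 * (\<Sum>k=1..d. 8 * (\<Prod>j=1..k. real (N n j) powr (1 - p) * e j))"
    by (intro arg_cong2[where f = "(*)"] sum.cong level refl)
  also have "\<dots> = 48 * (\<Sum>k=1..d. \<Prod>j=1..k. real (N n j) powr (1 - p) * e j)"
    by (simp only: sum_distrib_left[symmetric])
  finally show "expectation (\<lambda>\<omega>. norm (f \<omega>) powr p) \<le> 48 * (\<Sum>k=1..d. \<Prod>j=1..k. real (N n j) powr (1 - p)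
      * exp (real n * a j / 2 * (p * (p - 1) * (Re \<beta>)\<^sup>2 + p * (Im \<beta>)\<^sup>2)))"
    unfolding e_def .
qed

section \<open>Exponential decay near a point of \<open>E1\<close>\<close>

text \<open>As \<open>1 - p \<le> 0\<close>, a lower bound on \<open>N\<close> bounds the power from
  above, the halving costing at most \<open>2\<close>. The square root is the critical value of the
  level at hand; \<open>s\<close> will be that of the first level, so that one
  \<open>\<delta>\<close> serves all levels.\<close>

lemma level_factor_le:
  fixes A :: real
  assumes "1 \<le> p" "p \<le> 2" "A > 0" "\<alpha> > 1" "N \<ge> \<alpha> ^ n / 2"
    and s: "0 \<le> s" "s \<le> sqrt (2 * ln \<alpha> / A)" and Q: "Q - (p - 1) * s\<^sup>2 \<le> - \<delta>"
  shows "N powr (1 - p) * exp (real n * A / 2 * Q) \<le> 2 * exp (- (real n * A / 2 * \<delta>))"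
proof -
  have "s\<^sup>2 \<le> 2 * ln \<alpha> / A"
    using power_mono[OF s(2,1), of 2] assms by simp
  then have ln: "A / 2 * s\<^sup>2 \<le> ln \<alpha>" using assms by (simp add: field_simps)
  have "N powr (1 - p) \<le> (\<alpha> ^ n / 2) powr (1 - p)"
    using assms by (intro powr_mono2') auto
  also have "\<dots> = 2 powr (p - 1) * exp (- (real n * (p - 1) * ln \<alpha>))"
    using assms by (simp add: powr_divide powr_def ln_div ln_realpow mult_exp_exp algebra_simps)
  also have "\<dots> \<le> 2 * exp (- (real n * (p - 1) * (A / 2 * s\<^sup>2)))"
  proof (rule mult_mono)
    show "2 powr (p - 1) \<le> 2" using assms powr_mono[of "p - 1" 1 2] by simp
    have "real n * (p - 1) * (A / 2 * s\<^sup>2) \<le> real n * (p - 1) * ln \<alpha>"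
      using assms ln by (intro mult_left_mono) auto
    then show "exp (- (real n * (p - 1) * ln \<alpha>)) \<le> exp (- (real n * (p - 1) * (A / 2 * s\<^sup>2)))"
      by simp
  qed auto
  finally have "N powr (1 - p) * exp (real n * A / 2 * Q)
      \<le> 2 * exp (- (real n * (p - 1) * (A / 2 * s\<^sup>2))) * exp (real n * A / 2 * Q)"
    by (intro mult_right_mono) auto
  also have "\<dots> = 2 * exp (real n * A / 2 * (Q - (p - 1) * s\<^sup>2))"
    by (simp add: mult_exp_exp field_simps)
  also have "\<dots> \<le> 2 * exp (real n * A / 2 * (- \<delta>))"
    using Q \<open>A > 0\<close> by (intro mult_left_mono iffD2[OF exp_le_cancel_iff]) auto
  finally show ?thesis by simp
qed

text \<open>Norms are split at the threshold \<open>exp (- \<eta>)\<close>: smaller ones are bounded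
  by it, larger ones by \<open>exp \<eta>\<close> times their \<open>p\<close>-th power. Half of the
  decay rate \<open>2 * \<eta>\<close> survives.\<close>

lemma (in prob_space) nn_integral_norm_le_moment:
  fixes f :: "'a \<Rightarrow> complex"
  assumes p: "1 \<le> p" "p \<le> 2" and "\<eta> \<ge> 0" "C \<ge> 0"
    and int: "integrable M (\<lambda>\<omega>. norm (f \<omega>) powr p)"
    and le: "expectation (\<lambda>\<omega>. norm (f \<omega>) powr p) \<le> C * exp (- 2 * \<eta>)"
  shows "(\<integral>\<^sup>+ \<omega>. ennreal (norm (f \<omega>)) \<partial>M) \<le> ennreal ((1 + C) * exp (- \<eta>))"
proof -
  have pw: "norm z \<le> exp (- \<eta>) + exp \<eta> * norm z powr p" for z :: complex
  proof (cases "norm z \<le> exp (- \<eta>)")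
    case True then show ?thesis by (intro add_increasing2) auto
  next
    case False
    then have z: "norm z > 0" "norm z > exp (- \<eta>)" using exp_gt_zero[of "- \<eta>"] by linarith+
    have "norm z = norm z powr p * norm z powr (1 - p)"
      using z by (simp flip: powr_add)
    also have "\<dots> \<le> norm z powr p * exp (- \<eta>) powr (1 - p)"
      using z p by (intro mult_left_mono powr_mono2') auto
    also have "\<dots> \<le> norm z powr p * exp \<eta>"
    proof -
      have "\<eta> * (p - 1) \<le> \<eta>" using p \<open>\<eta> \<ge> 0\<close> by (simp add: mult_left_le)
      then show ?thesis by (intro mult_left_mono) (auto simp: powr_def algebra_simps)
    qed
    finally have "norm z \<le> exp \<eta> * norm z powr p" by (simp add: mult.commute)
    then show ?thesis using exp_gt_zero[of "- \<eta>"] by linarith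
  qed
  have i: "integrable M (\<lambda>\<omega>. exp (- \<eta>) + exp \<eta> * norm (f \<omega>) powr p)"
    using int by simp
  have "(\<integral>\<^sup>+ \<omega>. ennreal (norm (f \<omega>)) \<partial>M) \<le> (\<integral>\<^sup>+ \<omega>. ennreal (exp (- \<eta>) + exp \<eta> * norm (f \<omega>) powr p) \<partial>M)"
    by (intro nn_integral_mono ennreal_leI pw)
  also have "\<dots> = ennreal (expectation (\<lambda>\<omega>. exp (- \<eta>) + exp \<eta> * norm (f \<omega>) powr p))"
    by (rule nn_integral_eq_integral[OF i]) simp
  also have "expectation (\<lambda>\<omega>. exp (- \<eta>) + exp \<eta> * norm (f \<omega>) powr p)
      = exp (- \<eta>) + exp \<eta> * expectation (\<lambda>\<omega>. norm (f \<omega>) powr p)"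
    using int by (simp add: prob_space)
  also have "\<dots> \<le> exp (- \<eta>) + exp \<eta> * (C * exp (- 2 * \<eta>))"
    using le by (intro add_left_mono mult_left_mono) auto
  also have "\<dots> = (1 + C) * exp (- \<eta>)"
    by (simp add: algebra_simps mult_exp_exp)
  finally show ?thesis by (simp add: ennreal_leI)
qed

text \<open>Formulated for every event on which the disc contains a zero, so that it applies to
  zeros in the part of a compact set lying in the disc.\<close>

lemma (in prob_space) grem_local_bound:
  fixes a \<alpha> :: "nat \<Rightarrow> real" and N :: "nat \<Rightarrow> nat \<Rightarrow> nat" and \<xi> :: "nat \<Rightarrow> nat list \<Rightarrow> 'a \<Rightarrow> real"
  assumes d: "d \<ge> 1"
    and a: "\<And>j. j \<in> {1..d} \<Longrightarrow> a j > 0"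
    and \<alpha>: "\<And>j. j \<in> {1..d} \<Longrightarrow> \<alpha> j > 1"
    and lim: "\<And>j. j \<in> {1..d} \<Longrightarrow> (\<lambda>n. real (N n j) / \<alpha> j ^ n) \<longlonglongrightarrow> 1"
    and mono: "\<And>j. j \<in> {1..d} \<Longrightarrow> grem_sigma a \<alpha> 1 \<le> grem_sigma a \<alpha> j"
    and ind: "\<And>n. indep_vars (\<lambda>_. borel) (\<xi> n) (grem_index d N n)"
    and dist: "\<And>n w. w \<in> grem_index d N n \<Longrightarrow> distributed M lborel (\<xi> n w) std_normal_density"
    and z: "z \<in> E1 a \<alpha>"
  shows "\<exists>r C \<eta>. r > 0 \<and> C \<ge> 0 \<and> \<eta> > 0 \<and> (\<forall>\<^sub>F n in sequentially. \<forall>E\<in>events.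
      (\<forall>\<omega>\<in>E. \<exists>\<beta>\<in>cball z r. grem_Z d a N \<xi> n \<beta> \<omega> = 0) \<longrightarrow> prob E \<le> C * exp (- \<eta> * real n))"
proof -
  define s where "s = grem_sigma a \<alpha> 1"
  have one: "1 \<in> {1..d}" using d by simp
  have s: "s > 0" using a[OF one] \<alpha>[OF one] by (simp add: s_def grem_sigma_def)
  define \<Phi> where "\<Phi> p \<beta> = p * (p - 1) * (Re \<beta>)\<^sup>2 + p * (Im \<beta>)\<^sup>2 - (p - 1) * s\<^sup>2" for p :: real and \<beta>
  obtain p where p: "1 < p" "p \<le> 2" and "\<Phi> p z < 0"
    using E1_exponent[OF z s[unfolded s_def]] by (auto simp: \<Phi>_def s_def algebra_simps)
  \<comment> \<open>Half of the gap at \<open>z\<close> is kept, which leaves room for a whole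
    neighbourhood by continuity.\<close>
  define \<delta> where "\<delta> = - \<Phi> p z / 2"
  have \<delta>: "\<delta> > 0" "\<Phi> p z < - \<delta>" using \<open>\<Phi> p z < 0\<close> by (auto simp: \<delta>_def)
  have "(\<Phi> p \<longlongrightarrow> \<Phi> p z) (at z)" unfolding \<Phi>_def by (intro tendsto_intros)
  then have "\<forall>\<^sub>F \<beta> in at z. \<Phi> p \<beta> < - \<delta>"
    using order_tendstoD(2)[OF _ \<delta>(2)] by blast
  then obtain e where e: "e > 0" "\<And>\<beta>. dist \<beta> z < e \<Longrightarrow> \<Phi> p \<beta> < - \<delta>"
    using \<delta>(2) unfolding eventually_at by (metis UNIV_I)
  \<comment> \<open>The moment bound is needed up to the circle of radius \<open>2 * r\<close>,
    which must stay within distance \<open>e\<close> of \<open>z\<close>.\<close>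
  define r where "r = e / 4"
  have r: "r > 0" "2 * r < e" using e(1) by (auto simp: r_def)
  \<comment> \<open>The first level decays at rate \<open>a 1 * \<delta> / 2\<close>; the passage
    from the \<open>p\<close>-th to the first moment halves it.\<close>
  define \<eta> where "\<eta> = a 1 * \<delta> / 4"
  have \<eta>: "\<eta> > 0" using a[OF one] \<delta> by (simp add: \<eta>_def)
  define C where "C = 48 * (real d * 2 ^ d)"
  have C: "C \<ge> 0" by (simp add: C_def)
  have "\<forall>\<^sub>F n in sequentially. \<forall>j\<in>{1..d}. real (N n j) \<ge> \<alpha> j ^ n / 2"
  proof (intro eventually_ball_finite ballI finite_atLeastAtMost)
    fix j assume j: "j \<in> {1..d}"
    have "\<forall>\<^sub>F n in sequentially. 1 / 2 < real (N n j) / \<alpha> j ^ n"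
      by (rule order_tendstoD(1)[OF lim[OF j]]) simp
    then show "\<forall>\<^sub>F n in sequentially. real (N n j) \<ge> \<alpha> j ^ n / 2"
      by eventually_elim (use \<alpha>[OF j] in \<open>simp add: field_simps\<close>)
  qed
  then have "\<forall>\<^sub>F n in sequentially. \<forall>E\<in>events.
      (\<forall>\<omega>\<in>E. \<exists>\<beta>\<in>cball z r. grem_Z d a N \<xi> n \<beta> \<omega> = 0) \<longrightarrow> prob E \<le> (2 * (1 + C)) * exp (- \<eta> * real n)"
  proof eventually_elim
    case (elim n)
    have N: "N n j > 0" if "j \<in> {1..d}" for j
    proof -
      have "0 < \<alpha> j ^ n / 2" using \<alpha>[OF that] by simp
      then show ?thesis using bspec[OF elim that] by linarith
    qed
    define f where "f \<beta> \<omega> = (\<Sum>w\<in>grem_words N n d. path_prod (grem_Y a n (\<xi> n) \<beta>) w \<omega>)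
        / of_nat (\<Prod>j=1..d. N n j) - 1" for \<beta> \<omega>
    have rv: "\<xi> n w \<in> borel_measurable M" if "w \<in> grem_index d N n" for w
      using distributed_measurable[OF dist[OF that]] by simp
    have hol: "(\<lambda>\<beta>. f \<beta> \<omega>) holomorphic_on UNIV" for \<omega>
      unfolding f_def path_prod_def grem_Y_def by (intro holomorphic_intros) (use N in auto)
    have grem_Y_meas: "(\<lambda>x. grem_Y a n (\<xi> n) (snd x) v (fst x)) \<in> borel_measurable (M \<Otimes>\<^sub>M borel)"
      if "v \<in> grem_index d N n" for v
    proof -
      note [measurable] = rv[OF that]
      show ?thesis unfolding grem_Y_def by measurable
    qed
    have meas: "(\<lambda>(\<omega>, \<beta>). f \<beta> \<omega>) \<in> borel_measurable (M \<Otimes>\<^sub>M borel)"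
      unfolding f_def path_prod_def case_prod_beta
      by (intro borel_measurable_diff borel_measurable_divide borel_measurable_sum borel_measurable_prod
          borel_measurable_const grem_Y_meas take_grem_index)
        (auto dest: length_grem_words)
    have bound: "(\<integral>\<^sup>+ \<omega>. ennreal (norm (f \<beta> \<omega>)) \<partial>M) \<le> ennreal ((1 + C) * exp (- (\<eta> * real n)))"
      if "\<beta> \<in> cball z (2 * r)" for \<beta>
    proof (rule nn_integral_norm_le_moment)
      show "1 \<le> p" "p \<le> 2" "0 \<le> \<eta> * real n" "0 \<le> C" using p \<eta> C by auto
      show "integrable M (\<lambda>\<omega>. norm (f \<beta> \<omega>) powr p)"
        unfolding f_def by (rule grem_moment_le(1)[OF \<open>1 \<le> p\<close> \<open>p \<le> 2\<close> a N ind dist])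
      have m: "expectation (\<lambda>\<omega>. norm (f \<beta> \<omega>) powr p) \<le> 48 * (\<Sum>k=1..d. \<Prod>j=1..k. real (N n j) powr (1 - p)
          * exp (real n * a j / 2 * (p * (p - 1) * (Re \<beta>)\<^sup>2 + p * (Im \<beta>)\<^sup>2)))"
        unfolding f_def by (rule grem_moment_le(2)[OF \<open>1 \<le> p\<close> \<open>p \<le> 2\<close> a N ind dist])
      have "dist \<beta> z < e" using that r by (simp add: dist_commute)
      then have Q: "(p * (p - 1) * (Re \<beta>)\<^sup>2 + p * (Im \<beta>)\<^sup>2) - (p - 1) * s\<^sup>2 \<le> - \<delta>"
        using e(2)[of \<beta>] by (simp add: \<Phi>_def)
      have level: "(\<Prod>j=1..k. real (N n j) powr (1 - p)
          * exp (real n * a j / 2 * (p * (p - 1) * (Re \<beta>)\<^sup>2 + p * (Im \<beta>)\<^sup>2)))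
          \<le> 2 ^ d * exp (- 2 * (\<eta> * real n))" if k: "k \<in> {1..d}" for k
      proof -
        have "(\<Prod>j=1..k. real (N n j) powr (1 - p)
            * exp (real n * a j / 2 * (p * (p - 1) * (Re \<beta>)\<^sup>2 + p * (Im \<beta>)\<^sup>2)))
          \<le> (\<Prod>j=1..k. 2 * exp (- (real n * a j / 2 * \<delta>)))"
        proof (intro prod_mono conjI)
          fix j assume "j \<in> {1..k}"
          then have j: "j \<in> {1..d}" using k by auto
          show "real (N n j) powr (1 - p)
              * exp (real n * a j / 2 * (p * (p - 1) * (Re \<beta>)\<^sup>2 + p * (Im \<beta>)\<^sup>2))
            \<le> 2 * exp (- (real n * a j / 2 * \<delta>))"
            using p a[OF j] \<alpha>[OF j] bspec[OF elim j] s mono[OF j]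
            by (intro level_factor_le[OF _ _ _ _ _ _ _ Q]) (auto simp: s_def grem_sigma_def)
        qed simp
        also have "\<dots> = 2 ^ k * exp (- (\<Sum>j=1..k. real n * a j / 2 * \<delta>))"
          by (simp add: prod.distrib exp_sum flip: sum_negf)
        \<comment> \<open>Only the decay of the first level is kept, the further levels contributing
          nonnegative rates. This makes the bound uniform in \<open>k\<close>.\<close>
        also have "\<dots> \<le> 2 ^ d * exp (- (real n * a 1 / 2 * \<delta>))"
        proof -
          have "real n * a 1 / 2 * \<delta> \<le> (\<Sum>j=1..k. real n * a j / 2 * \<delta>)"
            using k \<delta> a by (intro member_le_sum) (auto simp: less_imp_le)
          then show ?thesis using k by (intro mult_mono power_increasing) auto
        qed
        also have "real n * a 1 / 2 * \<delta> = 2 * (\<eta> * real n)" by (simp add: \<eta>_def)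
        finally show ?thesis by simp
      qed
      have "expectation (\<lambda>\<omega>. norm (f \<beta> \<omega>) powr p)
          \<le> 48 * (\<Sum>k=1..d. 2 ^ d * exp (- 2 * (\<eta> * real n)))"
        by (rule order_trans[OF m], intro mult_left_mono sum_mono level) auto
      also have "\<dots> = C * exp (- 2 * (\<eta> * real n))" by (simp add: C_def)
      finally show "expectation (\<lambda>\<omega>. norm (f \<beta> \<omega>) powr p) \<le> C * exp (- 2 * (\<eta> * real n))" .
    qed
    show ?case
    proof (intro ballI impI)
      fix E assume E: "E \<in> events" and Z: "\<forall>\<omega>\<in>E. \<exists>\<beta>\<in>cball z r. grem_Z d a N \<xi> n \<beta> \<omega> = 0"
      have "\<exists>\<beta>\<in>cball z r. norm (f \<beta> \<omega>) \<ge> 1" if "\<omega> \<in> E" for \<omega>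
      proof -
        obtain \<beta> where \<beta>: "\<beta> \<in> cball z r" "grem_Z d a N \<xi> n \<beta> \<omega> = 0" using Z \<open>\<omega> \<in> E\<close> by blast
        then have "f \<beta> \<omega> = - 1" by (simp add: grem_Z_eq f_def)
        then show ?thesis using \<beta>(1) by (intro bexI[of _ \<beta>]) auto
      qed
      then have "prob E \<le> 2 * ((1 + C) * exp (- (\<eta> * real n)))"
        using C by (intro prob_le_circle_mean[OF hol meas \<open>r > 0\<close> bound _ E]) auto
      then show "prob E \<le> (2 * (1 + C)) * exp (- \<eta> * real n)" by (simp add: algebra_simps)
    qed
  qed
  then show ?thesis using r(1) \<eta> C by (intro exI[of _ r] exI[of _ "2 * (1 + C)"] exI[of _ \<eta>]) auto
qed

theorem theorem2p23:
  fixes M :: "'w measure" and d :: nat and a \<alpha> :: "nat \<Rightarrow> real"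
    and N :: "nat \<Rightarrow> nat \<Rightarrow> nat" and \<xi> :: "nat \<Rightarrow> nat list \<Rightarrow> 'w \<Rightarrow> real"
    and K :: "complex set"
  assumes "prob_space M"
    and "d \<ge> 1"
    and "\<And>j. j \<in> {1..d} \<Longrightarrow> a j > 0"
    and "\<And>j. j \<in> {1..d} \<Longrightarrow> \<alpha> j > 1"
    and "\<And>j. j \<in> {1..d} \<Longrightarrow> (\<lambda>n. real (N n j) / \<alpha> j ^ n) \<longlonglongrightarrow> 1"
    and "strict_mono_on {1..d} (grem_sigma a \<alpha>)"
    and "\<And>n. prob_space.indep_vars M (\<lambda>_. borel) (\<xi> n) (grem_index d N n)"
    and "\<And>n w. w \<in> grem_index d N n \<Longrightarrow> distributed M lborel (\<xi> n w) std_normal_density"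
    and "compact K" and "K \<subseteq> E1 a \<alpha>"
  shows "\<exists>C \<epsilon>. \<epsilon> > 0 \<and> (\<forall>n::nat.
           {\<omega> \<in> space M. \<exists>\<beta>\<in>K. grem_Z d a N \<xi> n \<beta> \<omega> = 0} \<in> sets M \<and>
           measure M {\<omega> \<in> space M. \<exists>\<beta>\<in>K. grem_Z d a N \<xi> n \<beta> \<omega> = 0} < C * exp (- \<epsilon> * real n))"
proof -
  interpret prob_space M by fact
  let ?E = "\<lambda>n K. {\<omega> \<in> space M. \<exists>\<beta>\<in>K. grem_Z d a N \<xi> n \<beta> \<omega> = 0}"
  have ev: "?E n K' \<in> events" if "compact K'" for n K'
  proof (rule sets_zero_set[OF that])
    show "continuous_on K' (\<lambda>\<beta>. grem_Z d a N \<xi> n \<beta> \<omega>)" for \<omega>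
      unfolding grem_Z_def by (intro continuous_intros)
    have X: "grem_X d a (\<xi> n) w \<in> borel_measurable M" if "w \<in> grem_words N n d" for w
      unfolding grem_X_def[abs_def]
    proof (intro borel_measurable_sum borel_measurable_times borel_measurable_const)
      fix j assume "j \<in> {1..d}"
      then have "take j w \<in> grem_index d N n" using that by (intro take_grem_index) auto
      from distributed_measurable[OF assms(8)[OF this]]
      show "\<xi> n (take j w) \<in> borel_measurable M" by simp
    qed
    show "grem_Z d a N \<xi> n \<beta> \<in> borel_measurable M" for \<beta>
      unfolding grem_Z_def[abs_def] grem_states_def
    proof (rule borel_measurable_sum)
      fix w assume "w \<in> grem_words N n d"
      note [measurable] = X[OF this]
      show "(\<lambda>\<omega>. exp (\<beta> * of_real (sqrt (real n)) * of_real (grem_X d a (\<xi> n) w \<omega>))) \<in> borel_measurable M"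
        by measurable
    qed
  qed
  have "grem_sigma a \<alpha> 1 \<le> grem_sigma a \<alpha> j" if "j \<in> {1..d}" for j
    using strict_mono_onD[OF assms(6), of 1 j] that by (cases "j = 1") auto
  note mono = this
  \<comment> \<open>Packing the conditions into one predicate lets radius, constant and rate be
    chosen simultaneously as functions of the centre.\<close>
  define local_bound where "local_bound z r C \<eta> \<longleftrightarrow> r > 0 \<and> C \<ge> 0 \<and> \<eta> > 0 \<and>
      (\<forall>\<^sub>F n in sequentially. \<forall>E\<in>events. (\<forall>\<omega>\<in>E. \<exists>\<beta>\<in>cball z r. grem_Z d a N \<xi> n \<beta> \<omega> = 0)
        \<longrightarrow> prob E \<le> C * exp (- \<eta> * real n))" for z and r C \<eta> :: real
  have "\<exists>r C \<eta>. local_bound z r C \<eta>" if "z \<in> K" for z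
    unfolding local_bound_def
    by (rule grem_local_bound[OF assms(2-5) mono assms(7,8) subsetD[OF assms(10) that]])
  then obtain r C \<eta> where "\<And>z. z \<in> K \<Longrightarrow> local_bound z (r z) (C z) (\<eta> z)"
    by metis
  then have loc: "r z > 0" "C z \<ge> 0" "\<eta> z > 0"
    and ev_loc: "\<forall>\<^sub>F n in sequentially. \<forall>E\<in>events.
      (\<forall>\<omega>\<in>E. \<exists>\<beta>\<in>cball z (r z). grem_Z d a N \<xi> n \<beta> \<omega> = 0) \<longrightarrow> prob E \<le> C z * exp (- \<eta> z * real n)"
    if "z \<in> K" for z
    using that unfolding local_bound_def by blast+
  have "K \<subseteq> (\<Union>z\<in>K. ball z (r z))" using loc by auto
  then obtain D where D: "D \<subseteq> K" "finite D" "K \<subseteq> (\<Union>z\<in>D. ball z (r z))"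
    using compactE_image[OF assms(9), of K "\<lambda>z. ball z (r z)"] by auto
  \<comment> \<open>The inserted \<open>1\<close> keeps the minimum defined when \<open>D\<close> is
    empty.\<close>
  define \<epsilon> where "\<epsilon> = Min (insert 1 (\<eta> ` D))"
  have \<epsilon>: "\<epsilon> > 0" "\<And>z. z \<in> D \<Longrightarrow> \<epsilon> \<le> \<eta> z"
    using D loc by (auto simp: \<epsilon>_def)
  have "\<forall>\<^sub>F n in sequentially. \<forall>z\<in>D. \<forall>E\<in>events.
      (\<forall>\<omega>\<in>E. \<exists>\<beta>\<in>cball z (r z). grem_Z d a N \<xi> n \<beta> \<omega> = 0) \<longrightarrow> prob E \<le> C z * exp (- \<eta> z * real n)"
    by (intro eventually_ball_finite ballI ev_loc) (use D in auto)
  then obtain n0 where n0: "\<And>n z E. n \<ge> n0 \<Longrightarrow> z \<in> D \<Longrightarrow> E \<in> events \<Longrightarrow>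
      (\<forall>\<omega>\<in>E. \<exists>\<beta>\<in>cball z (r z). grem_Z d a N \<xi> n \<beta> \<omega> = 0) \<Longrightarrow> prob E \<le> C z * exp (- \<eta> z * real n)"
    unfolding eventually_sequentially by blast
  \<comment> \<open>The sum serves \<open>n \<ge> n0\<close>, the exponential covers smaller
    \<open>n\<close> through the trivial bound \<open>1\<close> on probabilities, and the final
    \<open>1\<close> gives strictness in the latter case.\<close>
  define B where "B = (\<Sum>z\<in>D. C z) + exp (\<epsilon> * real n0) + 1"
  have C0: "(\<Sum>z\<in>D. C z) \<ge> 0" using D loc by (intro sum_nonneg) auto
  have "prob (?E n K) < B * exp (- \<epsilon> * real n)" for n
  proof (cases "n \<ge> n0")
    case True
    \<comment> \<open>Intersecting with the closed discs keeps the sets compact, so the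
      corresponding zero events are measurable.\<close>
    have comp: "compact (K \<inter> cball z (r z))" for z using assms(9) by (intro compact_Int) auto
    have "prob (?E n K) \<le> prob (\<Union>z\<in>D. ?E n (K \<inter> cball z (r z)))"
    proof (rule finite_measure_mono)
      show "?E n K \<subseteq> (\<Union>z\<in>D. ?E n (K \<inter> cball z (r z)))"
      proof
        fix \<omega> assume "\<omega> \<in> ?E n K"
        then obtain \<beta> where \<beta>: "\<omega> \<in> space M" "\<beta> \<in> K" "grem_Z d a N \<xi> n \<beta> \<omega> = 0" by blast
        then obtain z where "z \<in> D" "\<beta> \<in> ball z (r z)" using D(3) by blast
        moreover from this have "\<beta> \<in> K \<inter> cball z (r z)" using \<beta> by simp
        ultimately show "\<omega> \<in> (\<Union>z\<in>D. ?E n (K \<inter> cball z (r z)))" using \<beta> by blast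
      qed
    qed (use D ev[OF comp] in auto)
    also have "\<dots> \<le> (\<Sum>z\<in>D. prob (?E n (K \<inter> cball z (r z))))"
      by (rule finite_measure_subadditive_finite) (use D ev[OF comp] in auto)
    also have "\<dots> \<le> (\<Sum>z\<in>D. C z * exp (- \<epsilon> * real n))"
    proof (rule sum_mono)
      fix z assume z: "z \<in> D"
      have "prob (?E n (K \<inter> cball z (r z))) \<le> C z * exp (- \<eta> z * real n)"
        by (rule n0[OF True z ev[OF comp]]) auto
      also have "\<dots> \<le> C z * exp (- \<epsilon> * real n)"
        using loc[of z] z D(1) \<epsilon>(2)[OF z] by (auto intro!: mult_left_mono mult_right_mono)
      finally show "prob (?E n (K \<inter> cball z (r z))) \<le> C z * exp (- \<epsilon> * real n)" .
    qed
    also have "\<dots> = (\<Sum>z\<in>D. C z) * exp (- \<epsilon> * real n)" by (simp add: sum_distrib_right)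
    also have "\<dots> < B * exp (- \<epsilon> * real n)"
      using exp_gt_zero[of "\<epsilon> * real n0"] unfolding B_def by (intro mult_strict_right_mono exp_gt_zero) linarith
    finally show ?thesis .
  next
    case False
    have "prob (?E n K) \<le> 1" by simp
    also have "\<dots> \<le> exp (\<epsilon> * real n0) * exp (- \<epsilon> * real n)"
      using False \<epsilon>(1) by (simp add: mult_exp_exp)
    also have "\<dots> < B * exp (- \<epsilon> * real n)"
      using C0 unfolding B_def by (intro mult_strict_right_mono) auto
    finally show ?thesis .
  qed
  then show ?thesis using \<epsilon>(1) ev[OF assms(9)] by blast
qed

end
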